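(* Assume that $B(t)$ has rank $n$ for every $t\in[0,T-h]$, and let $\overline B(t)=\Phi_A(t,t+h)B(t+h)$. Let $S$ be a symmetric positive semi-definite $n\times n$ real matrix. Then for $t\in[0,T-h]$ there exists a matrix $K(t)\in\mathbb R^{m\times n}$ such that $$\overline B(t)K(t)=I .$$ In particular, for $k\ge1$, with the feedback control $$U_k(t)=-K(t)\big(A(t)+kI\big)Y_k(t),$$ the solution $Y_k$ of $$dY_k(t)=\big(A(t)Y_k(t)+\overline B(t)U_k(t)\big)\,dt+\sigma(t)\,dW_t,\qquad Y_k(0)=0,$$ satisfies, for all $t\in[0,T-h]$, $$\mathbb E\big[Y_k(t)^TSY_k(t)\big]\le\frac{\|S\|\,\|\sigma\|_\infty^2}{2k}.$$
   Context: Let $n,m$ be positive integers, $T>0$ and $0<h<T$. Let $(\Omega,(\mathcal F_t)_{t\ge0},\mathbb P)$ be a filtered probability space carrying a one-dimensional Wiener process $W$ with respect to $(\mathcal F_t)$. For an $L^\infty$ matrix function $M$, $\Phi_M(t,s)$ is the fundamental matrix: $\frac{d}{dt}\Phi_M(t,s)=M(t)\Phi_M(t,s)$, $\Phi_M(s,s)=I$. $\|S\|$ is the operator norm induced by the Euclidean norm; $\|\sigma\|_\infty$ is the essential supremum over $[0,T]$ of the Euclidean norm of $\sigma$. Standing assumptions: $A\in L^\infty([0,T+h],\mathbb R^{n\times n})$, $B\in L^\infty([0,T+h],\mathbb R^{n\times m})$, $\sigma\in L^\infty([0,T],\mathbb R^n)$ are deterministic, and the Gramian $G_\tau^{T+h}=\int_\tau^{T+h}\Phi_A(T+h,s)B(s)B(s)^T\Phi_A(T+h,s)^T\,ds$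 is invertible for all $0<\tau<T+h$.
   Formalization: The rank hypothesis is imposed on B(t+h) for t in [0,T-h] (i.e. B has rank n on [h,T]) instead of on B(t), since the literal claim fails, e.g. for n=m=1, T=1, h=1/2, A=0, B=1 except B(1)=0. *)

theory Defs
  imports "HOL-Probability.Probability"
begin

section \<open>Deterministic coefficients\<close>

definition Linfty_on :: "real set \<Rightarrow> (real \<Rightarrow> 'b::euclidean_space) \<Rightarrow> bool" where
  "Linfty_on D f \<longleftrightarrow>
     f \<in> borel_measurable (lebesgue_on D) \<and>
     esssup (lebesgue_on D) (\<lambda>t. ereal (norm (f t))) < \<infinity>"

definition Linfty_norm :: "real set \<Rightarrow> (real \<Rightarrow> 'b::euclidean_space) \<Rightarrow> real" where
  "Linfty_norm D f = real_of_ereal (esssup (lebesgue_on D) (\<lambda>t. ereal (norm (f t))))"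

text \<open>
  \<open>Phi t s\<close> is the fundamental matrix of the linear equation with coefficient matrix \<open>A\<close> on the
  interval \<open>{a..b}\<close>.  Since \<open>A\<close> is only essentially bounded, the matrix differential equation is
  understood in the sense of Caratheodory, that is, as the integral equation.  The integral is
  oriented: \<open>t < s\<close> is allowed.
\<close>

definition fundamental_matrix ::
    "real \<Rightarrow> real \<Rightarrow> (real \<Rightarrow> real^'n^'n) \<Rightarrow> (real \<Rightarrow> real \<Rightarrow> real^'n^'n) \<Rightarrow> bool" where
  "fundamental_matrix a b A Phi \<longleftrightarrow>
     (\<forall>s\<in>{a..b}. continuous_on {a..b} (\<lambda>t. Phi t s) \<and>
        (\<forall>t\<in>{a..b}. Phi t s = mat 1 + (LINT r=ereal s..ereal t|lebesgue. (A r ** Phi r s))))"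

definition gramian ::
    "(real \<Rightarrow> real \<Rightarrow> real^'n^'n) \<Rightarrow> (real \<Rightarrow> real^'m^'n) \<Rightarrow> real \<Rightarrow> real \<Rightarrow> real^'n^'n" where
  "gramian Phi B \<tau> b =
     (LINT s|lebesgue_on {\<tau>..b}. (Phi b s ** B s ** transpose (B s) ** transpose (Phi b s)))"

definition delayed_input ::
    "(real \<Rightarrow> real \<Rightarrow> real^'n^'n) \<Rightarrow> (real \<Rightarrow> real^'m^'n) \<Rightarrow> real \<Rightarrow> real \<Rightarrow> real^'m^'n" where
  "delayed_input Phi B h t = Phi t (t + h) ** B (t + h)"

definition feedback_control ::
    "(real \<Rightarrow> real^'n^'n) \<Rightarrow> (real \<Rightarrow> real^'n^'m) \<Rightarrow> real \<Rightarrow> (real \<Rightarrow> 'w \<Rightarrow> real^'n)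
       \<Rightarrow> real \<Rightarrow> 'w \<Rightarrow> real^'m" where
  "feedback_control A K k Y t \<omega> = - (K t *v ((A t + k *\<^sub>R mat 1) *v Y t \<omega>))"

definition pos_semidef :: "real^'n^'n \<Rightarrow> bool" where
  "pos_semidef S \<longleftrightarrow> (\<forall>x. 0 \<le> x \<bullet> (S *v x))"

section \<open>Wiener process and Ito integral\<close>

definition filtered_prob_space :: "'w measure \<Rightarrow> (real \<Rightarrow> 'w measure) \<Rightarrow> bool" where
  "filtered_prob_space M F \<longleftrightarrow>
     prob_space M \<and> (\<forall>t\<ge>0. subalgebra M (F t)) \<and>
     (\<forall>s t. 0 \<le> s \<longrightarrow> s \<le> t \<longrightarrow> sets (F s) \<subseteq> sets (F t))"

text \<open>The second argument of \<open>normal_density\<close> is the standard deviation, not the variance.\<close>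

definition wiener_process ::
    "'w measure \<Rightarrow> (real \<Rightarrow> 'w measure) \<Rightarrow> (real \<Rightarrow> 'w \<Rightarrow> real) \<Rightarrow> bool" where
  "wiener_process M F W \<longleftrightarrow>
     (\<forall>t\<ge>0. W t \<in> borel_measurable (F t)) \<and>
     (AE \<omega> in M. W 0 \<omega> = 0) \<and>
     (AE \<omega> in M. continuous_on {0..} (\<lambda>t. W t \<omega>)) \<and>
     (\<forall>s t. 0 \<le> s \<longrightarrow> s < t \<longrightarrow>
        distributed M lborel (\<lambda>\<omega>. W t \<omega> - W s \<omega>) (normal_density 0 (sqrt (t - s))) \<and>
        prob_space.indep_set M (sets (F s))
          (sets (vimage_algebra (space M) (\<lambda>\<omega>. W t \<omega> - W s \<omega>) borel)))"

text \<open>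
  Elementary processes are sums of \<open>e i \<omega>\<close> times the indicator of \<open>{p i..<p (Suc i)}\<close>, \<open>i < N\<close>,
  with \<open>e i\<close> bounded and measurable with respect to the past up to time \<open>p i\<close>.
\<close>

definition elementary_process ::
    "'w measure \<Rightarrow> (real \<Rightarrow> 'w measure) \<Rightarrow> real \<Rightarrow> real \<Rightarrow>
       nat \<Rightarrow> (nat \<Rightarrow> real) \<Rightarrow> (nat \<Rightarrow> 'w \<Rightarrow> 'b::euclidean_space) \<Rightarrow> bool" where
  "elementary_process M F a b N p e \<longleftrightarrow>
     p 0 = a \<and> p N = b \<and>
     (\<forall>i<N. p i \<le> p (Suc i) \<and> e i \<in> borel_measurable (F (p i)) \<and>
            (\<exists>C. \<forall>\<omega>\<in>space M. norm (e i \<omega>) \<le> C))"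

definition elementary_value ::
    "nat \<Rightarrow> (nat \<Rightarrow> real) \<Rightarrow> (nat \<Rightarrow> 'w \<Rightarrow> 'b::euclidean_space) \<Rightarrow> real \<Rightarrow> 'w \<Rightarrow> 'b" where
  "elementary_value N p e s \<omega> = (\<Sum>i<N. indicator {p i..<p (Suc i)} s *\<^sub>R e i \<omega>)"

definition elementary_integral ::
    "(real \<Rightarrow> 'w \<Rightarrow> real) \<Rightarrow> nat \<Rightarrow> (nat \<Rightarrow> real) \<Rightarrow> (nat \<Rightarrow> 'w \<Rightarrow> 'b::euclidean_space) \<Rightarrow> 'w \<Rightarrow> 'b" where
  "elementary_integral W N p e \<omega> = (\<Sum>i<N. (W (p (Suc i)) \<omega> - W (p i) \<omega>) *\<^sub>R e i \<omega>)"

text \<open>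
  \<open>has_ito_integral M F W f a b X\<close>: the random variable \<open>X\<close> is (a version of) the Ito integral of
  \<open>f\<close> against \<open>W\<close> over \<open>[a, b]\<close>, the mean square limit of the integrals of elementary processes
  that approximate \<open>f\<close> in mean square.
\<close>

definition has_ito_integral ::
    "'w measure \<Rightarrow> (real \<Rightarrow> 'w measure) \<Rightarrow> (real \<Rightarrow> 'w \<Rightarrow> real) \<Rightarrow>
       (real \<Rightarrow> 'w \<Rightarrow> 'b::euclidean_space) \<Rightarrow> real \<Rightarrow> real \<Rightarrow> ('w \<Rightarrow> 'b) \<Rightarrow> bool" where
  "has_ito_integral M F W f a b X \<longleftrightarrow>
     case_prod f \<in> borel_measurable (lebesgue_on {a..b} \<Otimes>\<^sub>M M) \<and>
     (\<forall>s\<in>{a..b}. f s \<in> borel_measurable (F s)) \<and>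
     X \<in> borel_measurable M \<and>
     (\<exists>N p e.
        (\<forall>j::nat. elementary_process M F a b (N j) (p j) (e j)) \<and>
        (\<lambda>j. \<integral>\<^sup>+\<omega>. (\<integral>\<^sup>+s. ennreal ((norm (f s \<omega> - elementary_value (N j) (p j) (e j) s \<omega>))\<^sup>2)
                \<partial>lebesgue_on {a..b}) \<partial>M) \<longlonglongrightarrow> 0 \<and>
        (\<lambda>j. \<integral>\<^sup>+\<omega>. ennreal ((norm (X \<omega> - elementary_integral W (N j) (p j) (e j) \<omega>))\<^sup>2) \<partial>M)
           \<longlonglongrightarrow> 0)"

text \<open>
  \<open>Y\<close> is a strong solution on \<open>[0, \<tau>]\<close> of \<open>dY = b dt + \<sigma> dW\<close>, \<open>Y 0 = y0\<close>.  The drift process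
  \<open>b\<close> may depend on \<open>Y\<close>; the diffusion coefficient \<open>\<sigma>\<close> is deterministic.
\<close>

definition ito_solution ::
    "'w measure \<Rightarrow> (real \<Rightarrow> 'w measure) \<Rightarrow> (real \<Rightarrow> 'w \<Rightarrow> real) \<Rightarrow> real \<Rightarrow>
       (real \<Rightarrow> 'w \<Rightarrow> 'b::euclidean_space) \<Rightarrow> (real \<Rightarrow> 'b) \<Rightarrow> 'b \<Rightarrow> (real \<Rightarrow> 'w \<Rightarrow> 'b) \<Rightarrow> bool" where
  "ito_solution M F W \<tau> b \<sigma> y0 Y \<longleftrightarrow>
     (\<forall>t\<in>{0..\<tau>}. Y t \<in> borel_measurable (F t)) \<and>
     (AE \<omega> in M. continuous_on {0..\<tau>} (\<lambda>t. Y t \<omega>)) \<and>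
     (AE \<omega> in M. integrable (lebesgue_on {0..\<tau>}) (\<lambda>s. b s \<omega>)) \<and>
     (\<forall>t\<in>{0..\<tau>}. \<exists>I. has_ito_integral M F W (\<lambda>s \<omega>. \<sigma> s) 0 t I \<and>
        (AE \<omega> in M. Y t \<omega> = y0 + (LINT s|lebesgue_on {0..t}. b s \<omega>) + I \<omega>))"

end

theory Submission
  imports Defs
begin

text \<open>
  A vector in the kernel of \<open>\<Phi>(t, t + h)\<close> is the value at \<open>t + h\<close> of a solution of \<open>y' = A y\<close> that
  vanishes at \<open>t\<close>, so it is \<open>0\<close> by Gronwall; hence \<open>\<Phi>(t, t + h) B(t + h)\<close> has rank \<open>n\<close> and is right invertible.
  The feedback turns the equation into \<open>dY = - k Y dt + \<sigma> dW\<close>, that is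
  \<open>exp(k t) Y(t) = \<integral>\<^sub>0\<^sup>t exp(k s) \<sigma>(s) dW(s)\<close>, and the Ito isometry gives
  \<open>E |Y(t)|\<^sup>2 \<le> \<parallel>\<sigma>\<parallel>\<^sup>2 \<integral>\<^sub>0\<^sup>t exp(-2 k (t - s)) ds \<le> \<parallel>\<sigma>\<parallel>\<^sup>2 / (2 k)\<close>.
  The weighted stochastic integral is avoided: with \<open>I(t)\<close> the Ito integral of \<open>\<sigma>\<close> over \<open>[0, t]\<close>, the
  sums \<open>\<Sum>\<^sub>i exp(k t\<^sub>i) (I(t\<^sub>i\<^sub>+\<^sub>1) - I(t\<^sub>i))\<close> over uniform partitions tend to \<open>exp(k t) Y(t)\<close> along almost
  every path, their second moments obey the same bound, and Fatou's lemma passes to the limit.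
\<close>

section \<open>Wiener increments: moments, independence of the past, products\<close>

locale wiener_space =
  fixes M :: "'w measure" and F :: "real \<Rightarrow> 'w measure" and W :: "real \<Rightarrow> 'w \<Rightarrow> real"
  assumes filtered: "filtered_prob_space M F"
    and wiener: "wiener_process M F W"

sublocale wiener_space \<subseteq> prob_space M
  using filtered by (simp add: filtered_prob_space_def)

context wiener_space
begin

lemma space_filtration: "0 \<le> t \<Longrightarrow> space (F t) = space M"
  using filtered by (auto simp: filtered_prob_space_def subalgebra_def)

lemma measurable_filtration_mono:
  assumes "f \<in> borel_measurable (F s)" "0 \<le> s" "s \<le> t"
  shows "f \<in> borel_measurable (F t)"
proof -
  have "subalgebra (F t) (F s)"
    using filtered assms space_filtration[of s] space_filtration[of t]
    by (auto simp: filtered_prob_space_def subalgebra_def)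
  then show ?thesis
    using assms(1) measurable_from_subalg by blast
qed

lemma measurable_filtration:
  assumes "f \<in> borel_measurable (F s)" "0 \<le> s"
  shows "f \<in> borel_measurable M"
  using filtered assms measurable_from_subalg unfolding filtered_prob_space_def by blast

lemma measurable_W: "0 \<le> s \<Longrightarrow> s \<le> t \<Longrightarrow> W s \<in> borel_measurable (F t)"
  using wiener measurable_filtration_mono by (auto simp: wiener_process_def)

lemma measurable_W' [measurable]: "0 \<le> s \<Longrightarrow> W s \<in> borel_measurable M"
  using measurable_W measurable_filtration by blast

lemma measurable_increment:
  "0 \<le> s \<Longrightarrow> s \<le> t \<Longrightarrow> t \<le> u \<Longrightarrow> (\<lambda>\<omega>. W t \<omega> - W s \<omega>) \<in> borel_measurable (F u)"
  using measurable_W by (intro borel_measurable_diff) auto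

lemma distributed_increment:
  "0 \<le> s \<Longrightarrow> s < t \<Longrightarrow>
    distributed M lborel (\<lambda>\<omega>. W t \<omega> - W s \<omega>) (normal_density 0 (sqrt (t - s)))"
  using wiener by (auto simp: wiener_process_def)

lemma increment_moments:
  assumes "0 \<le> s" "s \<le> t"
  shows "integrable M (\<lambda>\<omega>. W t \<omega> - W s \<omega>)"
    and "expectation (\<lambda>\<omega>. W t \<omega> - W s \<omega>) = 0"
    and "integrable M (\<lambda>\<omega>. (W t \<omega> - W s \<omega>)\<^sup>2)"
    and "expectation (\<lambda>\<omega>. (W t \<omega> - W s \<omega>)\<^sup>2) = t - s"
proof -
  have "integrable M (\<lambda>\<omega>. W t \<omega> - W s \<omega>) \<and> expectation (\<lambda>\<omega>. W t \<omega> - W s \<omega>) = 0 \<and>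
    integrable M (\<lambda>\<omega>. (W t \<omega> - W s \<omega>)\<^sup>2) \<and> expectation (\<lambda>\<omega>. (W t \<omega> - W s \<omega>)\<^sup>2) = t - s"
  \<comment> \<open>A zero increment has no density, so the normal law is available only for
    \<open>s < t\<close>; for \<open>s = t\<close> every claim is trivial.\<close>
  proof (cases "s = t")
    case False
    with assms have st: "s < t" by simp
    let ?D = "normal_density 0 (sqrt (t - s))"
    note D = distributed_increment[OF assms(1) st]
    have pos: "0 < sqrt (t - s)" using st by simp
    have nonneg: "\<And>x. 0 \<le> ?D x" by simp
    have i1: "integrable M (\<lambda>\<omega>. W t \<omega> - W s \<omega>)"
      using distributed_integrable[OF D, of "\<lambda>x. x"] integrable_normal_moment[OF pos, of 0 1]
        by simp
    have i2: "integrable M (\<lambda>\<omega>. (W t \<omega> - W s \<omega>)\<^sup>2)"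
      using distributed_integrable[OF D, of "\<lambda>x. x\<^sup>2"] integrable_normal_moment[OF pos, of 0 2]
        by simp
    have e1: "expectation (\<lambda>\<omega>. W t \<omega> - W s \<omega>) = 0"
      using normal_distributed_expectation[OF pos D] by simp
    have e2: "expectation (\<lambda>\<omega>. (W t \<omega> - W s \<omega>)\<^sup>2) = t - s"
      using normal_distributed_variance[OF pos D] e1 st by simp
    show ?thesis using i1 i2 e1 e2 by blast
  qed simp
  then show "integrable M (\<lambda>\<omega>. W t \<omega> - W s \<omega>)"
    and "expectation (\<lambda>\<omega>. W t \<omega> - W s \<omega>) = 0"
    and "integrable M (\<lambda>\<omega>. (W t \<omega> - W s \<omega>)\<^sup>2)"
    and "expectation (\<lambda>\<omega>. (W t \<omega> - W s \<omega>)\<^sup>2) = t - s"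
    by auto
qed

text \<open>The sigma algebra generated by \<open>X\<close> lies in \<open>F s\<close>, and
  independence of two families of events passes to subfamilies.\<close>

lemma indep_var_increment:
  assumes "0 \<le> s" "s < t" and X: "X \<in> borel_measurable (F s)"
  shows "indep_var borel X borel (\<lambda>\<omega>. W t \<omega> - W s \<omega>)"
proof -
  let ?D = "\<lambda>\<omega>. W t \<omega> - W s \<omega>"
  have *: "indep_set (sets (F s)) (sets (vimage_algebra (space M) ?D borel))"
    using wiener assms(1,2) by (auto simp: wiener_process_def)
  have sub: "sigma_sets (space M) {X -` A \<inter> space M |A. A \<in> sets borel} \<subseteq> sets (F s)"
    unfolding space_filtration[OF assms(1), symmetric]
    using measurable_sets[OF X] by (intro sets.sigma_sets_subset) auto
  have "sigma_sets (space M) {?D -` A \<inter> space M |A. A \<in> sets borel} =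
      sets (vimage_algebra (space M) ?D borel)"
    by (simp add: sets_vimage_algebra)
  with * sub have "indep_set (sigma_sets (space M) {X -` A \<inter> space M |A. A \<in> sets borel})
      (sigma_sets (space M) {?D -` A \<inter> space M |A. A \<in> sets borel})"
    unfolding indep_set_def by (elim indep_sets_mono_sets) (simp split: bool.split)
  then show ?thesis
    unfolding indep_var_eq using assms measurable_filtration[OF X] by auto
qed

text \<open>The martingale property of \<open>W\<close>: independence factorises the expectation,
  and the increment is centred.\<close>

lemma expectation_times_increment:
  assumes "0 \<le> s" "s \<le> t" and X: "X \<in> borel_measurable (F s)" "integrable M X"
  shows "integrable M (\<lambda>\<omega>. X \<omega> * (W t \<omega> - W s \<omega>))"
    and "expectation (\<lambda>\<omega>. X \<omega> * (W t \<omega> - W s \<omega>)) = 0"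
proof -
  have "integrable M (\<lambda>\<omega>. X \<omega> * (W t \<omega> - W s \<omega>)) \<and>
      expectation (\<lambda>\<omega>. X \<omega> * (W t \<omega> - W s \<omega>)) = 0"
  proof (cases "s = t")
    case False
    with assms have iv: "indep_var borel X borel (\<lambda>\<omega>. W t \<omega> - W s \<omega>)"
      by (intro indep_var_increment) auto
    show ?thesis
      using indep_var_integrable[OF iv X(2) increment_moments(1)[OF assms(1,2)]]
        indep_var_lebesgue_integral[OF iv X(2) increment_moments(1)[OF assms(1,2)]]
        increment_moments(2)[OF assms(1,2)] by auto
  qed simp
  then show "integrable M (\<lambda>\<omega>. X \<omega> * (W t \<omega> - W s \<omega>))"
    and "expectation (\<lambda>\<omega>. X \<omega> * (W t \<omega> - W s \<omega>)) = 0" by auto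
qed

lemma expectation_times_increment_square:
  assumes "0 \<le> s" "s \<le> t" and X: "X \<in> borel_measurable (F s)" "integrable M X"
  shows "integrable M (\<lambda>\<omega>. X \<omega> * (W t \<omega> - W s \<omega>)\<^sup>2)"
    and "expectation (\<lambda>\<omega>. X \<omega> * (W t \<omega> - W s \<omega>)\<^sup>2) = (t - s) * expectation X"
proof -
  have "integrable M (\<lambda>\<omega>. X \<omega> * (W t \<omega> - W s \<omega>)\<^sup>2) \<and>
      expectation (\<lambda>\<omega>. X \<omega> * (W t \<omega> - W s \<omega>)\<^sup>2) = (t - s) * expectation X"
  proof (cases "s = t")
    case False
    with assms have "indep_var borel X borel (\<lambda>\<omega>. W t \<omega> - W s \<omega>)"
      by (intro indep_var_increment) auto
    from indep_var_compose[OF this, of id borel "\<lambda>x. x\<^sup>2" borel]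
    have iv: "indep_var borel X borel (\<lambda>\<omega>. (W t \<omega> - W s \<omega>)\<^sup>2)"
      by (simp add: comp_def)
    show ?thesis
      using indep_var_integrable[OF iv X(2) increment_moments(3)[OF assms(1,2)]]
        indep_var_lebesgue_integral[OF iv X(2) increment_moments(3)[OF assms(1,2)]]
        increment_moments(4)[OF assms(1,2)] by auto
  qed simp
  then show "integrable M (\<lambda>\<omega>. X \<omega> * (W t \<omega> - W s \<omega>)\<^sup>2)"
    and "expectation (\<lambda>\<omega>. X \<omega> * (W t \<omega> - W s \<omega>)\<^sup>2) = (t - s) * expectation X" by auto
qed

lemma integrable_bounded_times:
  fixes X Y :: "'w \<Rightarrow> real"
  assumes "X \<in> borel_measurable M" "integrable M Y" "\<And>\<omega>. \<omega> \<in> space M \<Longrightarrow> \<bar>X \<omega>\<bar> \<le> C"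
  shows "integrable M (\<lambda>\<omega>. X \<omega> * Y \<omega>)"
proof (rule Bochner_Integration.integrable_bound[of M "\<lambda>\<omega>. C * Y \<omega>"])
  show "AE \<omega> in M. norm (X \<omega> * Y \<omega>) \<le> norm (C * Y \<omega>)"
    using assms(3) by (auto simp: abs_mult intro!: mult_right_mono order_trans[OF assms(3)])
qed (use assms in auto)

text \<open>As \<open>a \<le> c\<close>, the factor \<open>max 0 (min b d - c)\<close> is the length
  of the intersection of \<open>[a, b]\<close> and \<open>[c, d]\<close>. Cutting the increments at
  the ends of the intersection leaves one square, which contributes this length, and products of
  disjoint increments, which have mean zero.\<close>

lemma expectation_increment_product_ordered:
  assumes "0 \<le> a" "a \<le> b" "a \<le> c" "c \<le> d"
    and X: "X \<in> borel_measurable (F c)" and bdd: "\<And>\<omega>. \<omega> \<in> space M \<Longrightarrow> \<bar>X \<omega>\<bar> \<le> C"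
  shows "has_bochner_integral M (\<lambda>\<omega>. X \<omega> * ((W b \<omega> - W a \<omega>) * (W d \<omega> - W c \<omega>)))
    (max 0 (min b d - c) * expectation X)"
proof -
  have XM [measurable]: "X \<in> borel_measurable M"
    using measurable_filtration[OF X] assms by linarith
  have Xi: "integrable M X"
    using bdd by (intro integrable_const_bound[of _ C]) (auto intro: AE_I2)
  \<comment> \<open>At time \<open>y\<close>, where the later increment starts, \<open>X\<close> and
    the earlier increment are both known; their product is the past factor.\<close>
  have orth: "has_bochner_integral M (\<lambda>\<omega>. X \<omega> * ((W v \<omega> - W u \<omega>) * (W z \<omega> - W y \<omega>))) 0"
    if "0 \<le> u" "u \<le> v" "v \<le> y" "c \<le> y" "y \<le> z" for u v y z
  proof -
    have "(\<lambda>\<omega>. X \<omega> * (W v \<omega> - W u \<omega>)) \<in> borel_measurable (F y)"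
      using that assms measurable_filtration_mono[OF X, of y] measurable_increment[of u v y]
      by (intro borel_measurable_times) linarith+
    moreover have "integrable M (\<lambda>\<omega>. X \<omega> * (W v \<omega> - W u \<omega>))"
      by (rule integrable_bounded_times[OF XM increment_moments(1) bdd]) (use that in auto)
    ultimately show ?thesis
      using expectation_times_increment[of y z "\<lambda>\<omega>. X \<omega> * (W v \<omega> - W u \<omega>)"] that
      by (simp add: has_bochner_integral_iff mult.assoc)
  qed
  have sq: "has_bochner_integral M (\<lambda>\<omega>. X \<omega> * (W v \<omega> - W c \<omega>)\<^sup>2) ((v - c) * expectation X)"
    if "c \<le> v" for v
    using expectation_times_increment_square[of c v X] that assms X Xi
    by (simp add: has_bochner_integral_iff)
  show ?thesis
  proof (cases "b \<le> c")
    case True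
    then show ?thesis using orth[of a b c d] assms by auto
  next
    case False
    show ?thesis
    proof (cases "b \<le> d")
      case True
      \<comment> \<open>The intersection is \<open>[c, b]\<close>: the first increment is cut at
        \<open>c\<close>, the second one at \<open>b\<close>.\<close>
      have "has_bochner_integral M (\<lambda>\<omega>. X \<omega> * ((W c \<omega> - W a \<omega>) * (W d \<omega> - W c \<omega>)) +
          (X \<omega> * (W b \<omega> - W c \<omega>)\<^sup>2 + X \<omega> * ((W b \<omega> - W c \<omega>) * (W d \<omega> - W b \<omega>))))
          (0 + ((b - c) * expectation X + 0))"
        using assms False True by (intro has_bochner_integral_add orth sq) auto
      moreover have "(\<lambda>\<omega>. X \<omega> * ((W c \<omega> - W a \<omega>) * (W d \<omega> - W c \<omega>)) +
          (X \<omega> * (W b \<omega> - W c \<omega>)\<^sup>2 + X \<omega> * ((W b \<omega> - W c \<omega>) * (W d \<omega> - W b \<omega>)))) =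
          (\<lambda>\<omega>. X \<omega> * ((W b \<omega> - W a \<omega>) * (W d \<omega> - W c \<omega>)))"
        by (rule ext) algebra
      ultimately show ?thesis
        using False True by simp
    next
      case db: False
      \<comment> \<open>Now \<open>[c, d]\<close> lies inside \<open>[a, b]\<close>: only the first
        increment is cut, at \<open>c\<close> and at \<open>d\<close>.\<close>
      have "has_bochner_integral M (\<lambda>\<omega>. X \<omega> * ((W c \<omega> - W a \<omega>) * (W d \<omega> - W c \<omega>)) +
          (X \<omega> * (W d \<omega> - W c \<omega>)\<^sup>2 + X \<omega> * ((W d \<omega> - W c \<omega>) * (W b \<omega> - W d \<omega>))))
          (0 + ((d - c) * expectation X + 0))"
        using assms False db by (intro has_bochner_integral_add orth sq) auto
      moreover have "(\<lambda>\<omega>. X \<omega> * ((W c \<omega> - W a \<omega>) * (W d \<omega> - W c \<omega>)) +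
          (X \<omega> * (W d \<omega> - W c \<omega>)\<^sup>2 + X \<omega> * ((W d \<omega> - W c \<omega>) * (W b \<omega> - W d \<omega>)))) =
          (\<lambda>\<omega>. X \<omega> * ((W b \<omega> - W a \<omega>) * (W d \<omega> - W c \<omega>)))"
        by (rule ext) algebra
      ultimately show ?thesis
        using False db assms by simp
    qed
  qed
qed

text \<open>Form without an order of the two starting times; when \<open>c < a\<close>, the ordered
  case applies with the two intervals exchanged.\<close>

lemma expectation_increment_product:
  assumes "0 \<le> a" "a \<le> b" "0 \<le> c" "c \<le> d"
    and X: "X \<in> borel_measurable (F (max a c))" and bdd: "\<And>\<omega>. \<omega> \<in> space M \<Longrightarrow> \<bar>X \<omega>\<bar> \<le> C"
  shows "has_bochner_integral M (\<lambda>\<omega>. X \<omega> * ((W b \<omega> - W a \<omega>) * (W d \<omega> - W c \<omega>)))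
    (max 0 (min b d - max a c) * expectation X)"
proof (cases "a \<le> c")
  case True
  then show ?thesis
    using expectation_increment_product_ordered[of a b c d X C] assms by (simp add: max_absorb2)
next
  case False
  then show ?thesis
    using expectation_increment_product_ordered[of c d a b X C] assms
    by (simp add: max_absorb1 min.commute mult.commute[of "W b _ - _"])
qed

end

section \<open>Ito isometry for elementary processes\<close>

text \<open>Expanding the square gives products of two indicators, each the indicator of an
  intersection. The weights are those of \<open>expectation_increment_product\<close>, so that the
  isometry reduces to comparing two double sums.\<close>

lemma has_bochner_integral_norm_square_step:
  fixes v :: "'i \<Rightarrow> 'b::euclidean_space"
  assumes "finite L"
  shows "has_bochner_integral lborel
    (\<lambda>s. (norm (\<Sum>l\<in>L. indicator {p l..<q l} s *\<^sub>R v l))\<^sup>2)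
    (\<Sum>l\<in>L. \<Sum>m\<in>L. max 0 (min (q l) (q m) - max (p l) (p m)) * (v l \<bullet> v m))"
proof -
  have eq: "(norm (\<Sum>l\<in>L. indicator {p l..<q l} s *\<^sub>R v l))\<^sup>2 =
      (\<Sum>l\<in>L. \<Sum>m\<in>L. indicator {max (p l) (p m)..<min (q l) (q m)} s * (v l \<bullet> v m))" for s :: real
    unfolding power2_norm_eq_inner inner_sum_left inner_sum_right
    by (intro sum.cong refl) (auto simp: indicator_def inner_commute)
  have "has_bochner_integral lborel (\<lambda>s. indicator {a..<b} s * c) (max 0 (b - a) * c)" for a b c :: real
  proof (rule has_bochner_integral_mult_left)
    show "has_bochner_integral lborel (indicator {a..<b}) (max 0 (b - a))"
      using has_bochner_integral_real_indicator[of "{a..<b}" lborel] by (cases "a \<le> b") auto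
  qed
  then show ?thesis
    unfolding eq by (intro has_bochner_integral_sum) simp
qed

context wiener_space
begin

text \<open>The intervals may overlap arbitrarily. This covers combinations of elementary processes
  on different partitions without passing to a common refinement.\<close>

lemma elementary_family_isometry:
  fixes e :: "'i \<Rightarrow> 'w \<Rightarrow> 'b::euclidean_space"
  assumes L: "finite L"
    and pq: "\<And>l. l \<in> L \<Longrightarrow> 0 \<le> p l \<and> p l \<le> q l"
    and e: "\<And>l. l \<in> L \<Longrightarrow> e l \<in> borel_measurable (F (p l))"
    and bdd: "\<And>l. l \<in> L \<Longrightarrow> \<exists>C. \<forall>\<omega>\<in>space M. norm (e l \<omega>) \<le> C"
  shows "(\<integral>\<^sup>+\<omega>. ennreal ((norm (\<Sum>l\<in>L. (W (q l) \<omega> - W (p l) \<omega>) *\<^sub>R e l \<omega>))\<^sup>2) \<partial>M) =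
    (\<integral>\<^sup>+\<omega>. (\<integral>\<^sup>+s. ennreal ((norm (\<Sum>l\<in>L. indicator {p l..<q l} s *\<^sub>R e l \<omega>))\<^sup>2) \<partial>lborel) \<partial>M)"
proof -
  \<comment> \<open>\<open>ov l m\<close> is the length of the overlap of the intervals
    \<open>l\<close> and \<open>m\<close>. Both sides of the isometry are shown to equal
    \<open>?R\<close>.\<close>
  define ov where "ov l m = max 0 (min (q l) (q m) - max (p l) (p m))" for l m
  let ?R = "\<Sum>l\<in>L. \<Sum>m\<in>L. ov l m * expectation (\<lambda>\<omega>. e l \<omega> \<bullet> e m \<omega>)"
  have pair: "has_bochner_integral M
        (\<lambda>\<omega>. (e l \<omega> \<bullet> e m \<omega>) * ((W (q l) \<omega> - W (p l) \<omega>) * (W (q m) \<omega> - W (p m) \<omega>)))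
        (ov l m * expectation (\<lambda>\<omega>. e l \<omega> \<bullet> e m \<omega>))"
    and pair': "integrable M (\<lambda>\<omega>. e l \<omega> \<bullet> e m \<omega>)" if lm: "l \<in> L" "m \<in> L" for l m
  proof -
    obtain C D where C: "\<And>\<omega>. \<omega> \<in> space M \<Longrightarrow> norm (e l \<omega>) \<le> C"
      and D: "\<And>\<omega>. \<omega> \<in> space M \<Longrightarrow> norm (e m \<omega>) \<le> D"
      using bdd lm by metis
    have bd: "\<bar>e l \<omega> \<bullet> e m \<omega>\<bar> \<le> C * D" if "\<omega> \<in> space M" for \<omega>
      using mult_mono[OF C[OF that] D[OF that]] norm_ge_zero[of "e l \<omega>"] C[OF that]
        Cauchy_Schwarz_ineq2[of "e l \<omega>" "e m \<omega>"] by (smt (verit) norm_ge_zero)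
    have pm: "0 \<le> max (p l) (p m)"
      using pq[OF lm(1)] by auto
    have meas: "(\<lambda>\<omega>. e l \<omega> \<bullet> e m \<omega>) \<in> borel_measurable (F (max (p l) (p m)))"
      using measurable_filtration_mono[OF e[OF lm(1)], of "max (p l) (p m)"]
        measurable_filtration_mono[OF e[OF lm(2)], of "max (p l) (p m)"] pq lm
      by (intro borel_measurable_inner) auto
    show "has_bochner_integral M
        (\<lambda>\<omega>. (e l \<omega> \<bullet> e m \<omega>) * ((W (q l) \<omega> - W (p l) \<omega>) * (W (q m) \<omega> - W (p m) \<omega>)))
        (ov l m * expectation (\<lambda>\<omega>. e l \<omega> \<bullet> e m \<omega>))"
      unfolding ov_def using pq lm meas bd by (intro expectation_increment_product) auto
    show "integrable M (\<lambda>\<omega>. e l \<omega> \<bullet> e m \<omega>)"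
      using measurable_filtration[OF meas pm] bd
      by (intro integrable_const_bound[of _ "C * D"]) (auto intro: AE_I2)
  qed
  have "has_bochner_integral M (\<lambda>\<omega>. (norm (\<Sum>l\<in>L. (W (q l) \<omega> - W (p l) \<omega>) *\<^sub>R e l \<omega>))\<^sup>2) ?R"
  proof -
    have eq: "(norm (\<Sum>l\<in>L. (W (q l) \<omega> - W (p l) \<omega>) *\<^sub>R e l \<omega>))\<^sup>2 =
      (\<Sum>l\<in>L. \<Sum>m\<in>L. (e l \<omega> \<bullet> e m \<omega>) * ((W (q l) \<omega> - W (p l) \<omega>) * (W (q m) \<omega> - W (p m) \<omega>)))" for \<omega>
      unfolding power2_norm_eq_inner inner_sum_left inner_sum_right
      by (intro sum.cong refl) (simp add: mult_ac inner_commute)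
    show ?thesis
      unfolding eq by (intro has_bochner_integral_sum pair)
  qed
  then have lhs: "(\<integral>\<^sup>+\<omega>. ennreal ((norm (\<Sum>l\<in>L. (W (q l) \<omega> - W (p l) \<omega>) *\<^sub>R e l \<omega>))\<^sup>2) \<partial>M) = ennreal ?R"
    by (subst nn_integral_eq_integral) (auto simp: has_bochner_integral_iff)
  let ?Q = "\<lambda>\<omega>. \<Sum>l\<in>L. \<Sum>m\<in>L. ov l m * (e l \<omega> \<bullet> e m \<omega>)"
  note step = has_bochner_integral_norm_square_step[OF L, of p q, folded ov_def]
  \<comment> \<open>The summands of \<open>?Q\<close> have no fixed sign; the sum is nonnegative
    because it is the integral of a squared norm.\<close>
  have Q0: "0 \<le> ?Q \<omega>" for \<omega>
    using step[of "\<lambda>l. e l \<omega>", unfolded has_bochner_integral_iff, THEN conjunct2, symmetric] by simp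
  have inner: "(\<integral>\<^sup>+s. ennreal ((norm (\<Sum>l\<in>L. indicator {p l..<q l} s *\<^sub>R e l \<omega>))\<^sup>2) \<partial>lborel) = ennreal (?Q \<omega>)" for \<omega>
    using step[of "\<lambda>l. e l \<omega>"] by (subst nn_integral_eq_integral) (auto simp: has_bochner_integral_iff)
  have "has_bochner_integral M ?Q ?R"
    using pair' by (intro has_bochner_integral_sum has_bochner_integral_mult_right)
      (simp add: has_bochner_integral_iff)
  then have "(\<integral>\<^sup>+\<omega>. ennreal (?Q \<omega>) \<partial>M) = ennreal ?R"
    using Q0 by (subst nn_integral_eq_integral) (auto simp: has_bochner_integral_iff)
  with lhs inner show ?thesis by simp
qed

text \<open>Brings the partition points into the range of times in which the filtration and
  \<open>W\<close> are controlled.\<close>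

lemma elementary_process_nonneg:
  assumes "elementary_process M F 0 b N p e" "i \<le> N"
  shows "0 \<le> p i"
  using assms(2)
proof (induction i)
  case 0
  then show ?case using assms(1) by (simp add: elementary_process_def)
next
  case (Suc i)
  then have "p i \<le> p (Suc i)"
    using assms(1) by (auto simp: elementary_process_def)
  with Suc show ?case by simp
qed

text \<open>The subintervals of all processes form one family indexed by pairs, with the scalar
  \<open>c l\<close> absorbed into the coefficients. The processes may end at different times
  \<open>t l\<close>.\<close>

lemma elementary_combination_isometry:
  fixes e :: "'i \<Rightarrow> nat \<Rightarrow> 'w \<Rightarrow> 'b::euclidean_space"
  assumes L: "finite L"
    and el: "\<And>l. l \<in> L \<Longrightarrow> elementary_process M F 0 (t l) (N l) (p l) (e l)"
  shows "(\<integral>\<^sup>+\<omega>. ennreal ((norm (\<Sum>l\<in>L. c l *\<^sub>R elementary_integral W (N l) (p l) (e l) \<omega>))\<^sup>2) \<partial>M) =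
    (\<integral>\<^sup>+\<omega>. (\<integral>\<^sup>+s. ennreal ((norm (\<Sum>l\<in>L. c l *\<^sub>R elementary_value (N l) (p l) (e l) s \<omega>))\<^sup>2) \<partial>lborel) \<partial>M)"
proof -
  let ?I = "SIGMA l:L. {..<N l}"
  let ?e = "\<lambda>x \<omega>. c (fst x) *\<^sub>R e (fst x) (snd x) \<omega>"
  have "(\<integral>\<^sup>+\<omega>. ennreal ((norm (\<Sum>x\<in>?I. (W (p (fst x) (Suc (snd x))) \<omega> - W (p (fst x) (snd x)) \<omega>) *\<^sub>R ?e x \<omega>))\<^sup>2) \<partial>M) =
    (\<integral>\<^sup>+\<omega>. (\<integral>\<^sup>+s. ennreal ((norm (\<Sum>x\<in>?I. indicator {p (fst x) (snd x)..<p (fst x) (Suc (snd x))} s *\<^sub>R ?e x \<omega>))\<^sup>2) \<partial>lborel) \<partial>M)"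
  proof (rule elementary_family_isometry)
    fix x assume x: "x \<in> ?I"
    then have l: "fst x \<in> L" "snd x < N (fst x)" by auto
    note E = el[OF l(1)]
    show "0 \<le> p (fst x) (snd x) \<and> p (fst x) (snd x) \<le> p (fst x) (Suc (snd x))"
      using elementary_process_nonneg[OF E, of "snd x"] E l(2) by (auto simp: elementary_process_def)
    show "?e x \<in> borel_measurable (F (p (fst x) (snd x)))"
      using E l(2) by (auto simp: elementary_process_def)
    obtain C where "\<forall>\<omega>\<in>space M. norm (e (fst x) (snd x) \<omega>) \<le> C"
      using E l(2) by (auto simp: elementary_process_def)
    then show "\<exists>C. \<forall>\<omega>\<in>space M. norm (?e x \<omega>) \<le> C"
      by (intro exI[of _ "\<bar>c (fst x)\<bar> * C"]) (auto intro: mult_left_mono)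
  qed (use L in auto)
  then show ?thesis
    unfolding elementary_integral_def elementary_value_def scaleR_sum_right
    using L by (simp add: sum.Sigma split_def mult.commute)
qed

end

section \<open>From elementary processes to Ito integrals\<close>

text \<open>Triangle inequality, then Cauchy-Schwarz, which produces the factor
  \<open>card L\<close>.\<close>

lemma norm_sum_scaleR_square_le:
  fixes v :: "'i \<Rightarrow> 'b::real_normed_vector" and c :: "'i \<Rightarrow> real"
  shows "(norm (\<Sum>l\<in>L. c l *\<^sub>R v l))\<^sup>2 \<le> (\<Sum>l\<in>L. card L * (c l)\<^sup>2 * (norm (v l))\<^sup>2)"
proof -
  have "norm (\<Sum>l\<in>L. c l *\<^sub>R v l) \<le> (\<Sum>l\<in>L. \<bar>c l\<bar> * norm (v l))"
    by (rule order_trans[OF norm_sum]) simp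
  then have "(norm (\<Sum>l\<in>L. c l *\<^sub>R v l))\<^sup>2 \<le> (\<Sum>l\<in>L. \<bar>c l\<bar> * norm (v l))\<^sup>2"
    by (intro power_mono) auto
  also have "\<dots> \<le> (\<Sum>l\<in>L. (\<bar>c l\<bar> * norm (v l))\<^sup>2) * card L"
    by (rule sum_squared_le_sum_of_squares)
  also have "\<dots> = (\<Sum>l\<in>L. card L * (c l)\<^sup>2 * (norm (v l))\<^sup>2)"
    by (simp add: sum_distrib_left power_mult_distrib mult_ac)
  finally show ?thesis .
qed

text \<open>Young's inequality, weighted so that the factor of the main term \<open>u\<close> is
  close to 1 and the large factor falls on the error \<open>w\<close>.\<close>

lemma norm_add_square_le:
  fixes u w :: "'b::real_normed_vector"
  assumes "0 < \<epsilon>"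
  shows "(norm (u + w))\<^sup>2 \<le> (1 + \<epsilon>) * (norm u)\<^sup>2 + (1 + 1 / \<epsilon>) * (norm w)\<^sup>2"
proof -
  have "0 \<le> (\<epsilon> * norm u - norm w)\<^sup>2 / \<epsilon>"
    using assms by simp
  also have "\<dots> = \<epsilon> * (norm u)\<^sup>2 + (norm w)\<^sup>2 / \<epsilon> - 2 * norm u * norm w"
    using assms by (simp add: field_simps power2_eq_square)
  finally have "(norm u + norm w)\<^sup>2 \<le> (1 + \<epsilon>) * (norm u)\<^sup>2 + (1 + 1 / \<epsilon>) * (norm w)\<^sup>2"
    by (simp add: algebra_simps power2_eq_square)
  then show ?thesis
    using power_mono[OF norm_triangle_ineq norm_ge_zero, of u w 2] by (rule order_trans[rotated])
qed

text \<open>Here \<open>u\<close> is the main term and the \<open>v l\<close> are errors. Their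
  factors may blow up as \<open>\<epsilon>\<close> tends to 0, so the errors have to vanish first,
  with \<open>\<epsilon>\<close> fixed.\<close>

lemma nn_integral_square_perturbation:
  fixes u :: "'a \<Rightarrow> 'b::euclidean_space" and c :: "'i \<Rightarrow> real"
  assumes \<epsilon>: "0 < \<epsilon>"
    and [measurable]: "u \<in> borel_measurable N" "\<And>l. l \<in> L \<Longrightarrow> v l \<in> borel_measurable N"
  shows "(\<integral>\<^sup>+x. ennreal ((norm (u x + (\<Sum>l\<in>L. c l *\<^sub>R v l x)))\<^sup>2) \<partial>N) \<le>
    ennreal (1 + \<epsilon>) * (\<integral>\<^sup>+x. ennreal ((norm (u x))\<^sup>2) \<partial>N) +
    (\<Sum>l\<in>L. ennreal ((1 + 1 / \<epsilon>) * card L * (c l)\<^sup>2) * (\<integral>\<^sup>+x. ennreal ((norm (v l x))\<^sup>2) \<partial>N))"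
proof -
  have d: "0 \<le> (1 + 1 / \<epsilon>) * card L * (c l)\<^sup>2" for l
    using \<epsilon> by simp
  have "(\<integral>\<^sup>+x. ennreal ((norm (u x + (\<Sum>l\<in>L. c l *\<^sub>R v l x)))\<^sup>2) \<partial>N) \<le>
    (\<integral>\<^sup>+x. (ennreal (1 + \<epsilon>) * ennreal ((norm (u x))\<^sup>2) +
      (\<Sum>l\<in>L. ennreal ((1 + 1 / \<epsilon>) * card L * (c l)\<^sup>2) * ennreal ((norm (v l x))\<^sup>2))) \<partial>N)"
  proof (rule nn_integral_mono)
    fix x
    have "(norm (u x + (\<Sum>l\<in>L. c l *\<^sub>R v l x)))\<^sup>2 \<le>
        (1 + \<epsilon>) * (norm (u x))\<^sup>2 + (1 + 1 / \<epsilon>) * (\<Sum>l\<in>L. card L * (c l)\<^sup>2 * (norm (v l x))\<^sup>2)"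
      using \<epsilon> by (intro order_trans[OF norm_add_square_le[OF \<epsilon>]] add_left_mono mult_left_mono
          norm_sum_scaleR_square_le) auto
    also have "\<dots> = (1 + \<epsilon>) * (norm (u x))\<^sup>2 +
        (\<Sum>l\<in>L. ((1 + 1 / \<epsilon>) * card L * (c l)\<^sup>2) * (norm (v l x))\<^sup>2)"
      by (simp add: sum_distrib_left mult_ac)
    finally show "ennreal ((norm (u x + (\<Sum>l\<in>L. c l *\<^sub>R v l x)))\<^sup>2) \<le>
      ennreal (1 + \<epsilon>) * ennreal ((norm (u x))\<^sup>2) +
      (\<Sum>l\<in>L. ennreal ((1 + 1 / \<epsilon>) * card L * (c l)\<^sup>2) * ennreal ((norm (v l x))\<^sup>2))"
      using \<epsilon> d by (simp add: ennreal_mult[symmetric] sum_nonneg ennreal_plus[symmetric] ennreal_leI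
          del: ennreal_plus)
  qed
  also have "\<dots> = ennreal (1 + \<epsilon>) * (\<integral>\<^sup>+x. ennreal ((norm (u x))\<^sup>2) \<partial>N) +
    (\<Sum>l\<in>L. ennreal ((1 + 1 / \<epsilon>) * card L * (c l)\<^sup>2) * (\<integral>\<^sup>+x. ennreal ((norm (v l x))\<^sup>2) \<partial>N))"
    by (subst nn_integral_add, measurable, measurable, subst nn_integral_sum)
      (auto simp: nn_integral_cmult)
  finally show ?thesis .
qed

text \<open>All partition points lie in \<open>[a, b]\<close>. This allows integrals in time to be
  taken over the whole line.\<close>

lemma elementary_value_outside:
  assumes "elementary_process M F a b N p e" "s \<notin> {a..b}"
  shows "elementary_value N p e s \<omega> = 0"
proof -
  have mono: "p i \<le> p (Suc i)" if "i < N" for i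
    using assms(1) that by (auto simp: elementary_process_def)
  have ge: "a \<le> p i" if "i \<le> N" for i
    using that
  proof (induction i)
    case 0 then show ?case using assms(1) by (auto simp: elementary_process_def)
  next
    case (Suc i) then show ?case using mono[of i] by simp
  qed
  have le: "p i \<le> b" if "i \<le> N" for i
    using that
  proof (induction rule: inc_induct)
    case base then show ?case using assms(1) by (auto simp: elementary_process_def)
  next
    case (step i) then show ?case using mono[of i] by simp
  qed
  have "s \<notin> {p i..<p (Suc i)}" if "i < N" for i
    using ge[of i] le[of "Suc i"] that assms(2) by auto
  then show ?thesis
    unfolding elementary_value_def by (intro sum.neutral) auto
qed

context wiener_space
begin

text \<open>The integrand is jointly measurable in time and sample point, and one variable is
  integrated out. This measurability lets the outer integral be split over sums.\<close>

lemma measurable_elementary_value: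
  fixes \<sigma> :: "real \<Rightarrow> 'b::euclidean_space"
  assumes el: "elementary_process M F 0 b N p e"
    and [measurable]: "\<sigma> \<in> borel_measurable (lebesgue_on {0..b})"
  shows "(\<lambda>\<omega>. \<integral>\<^sup>+s. ennreal ((norm (\<sigma> s - elementary_value N p e s \<omega>))\<^sup>2) \<partial>lebesgue_on {0..b})
      \<in> borel_measurable M"
proof -
  interpret Q: finite_measure "lebesgue_on {0..b}"
    by (intro finite_measure_lebesgue_on) simp
  have e [measurable]: "e i \<in> borel_measurable M" if "i < N" for i
    using el elementary_process_nonneg[OF el, of i] that
    by (intro measurable_filtration[of _ "p i"]) (auto simp: elementary_process_def)
  have "(indicator {p i..<p (Suc i)} :: real \<Rightarrow> real) \<in> borel_measurable (lebesgue_on {0..b})" for i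
    by (intro measurable_restrict_space1 borel_measurable_indicator) auto
  then have "(\<lambda>x. \<sigma> (snd x) - (\<Sum>i<N. indicator {p i..<p (Suc i)} (snd x) *\<^sub>R e i (fst x)))
      \<in> borel_measurable (M \<Otimes>\<^sub>M lebesgue_on {0..b})"
    by (intro borel_measurable_diff borel_measurable_sum borel_measurable_scaleR
        measurable_compose[OF measurable_snd] measurable_compose[OF measurable_fst]) (auto intro: e assms)
  then show ?thesis
    unfolding elementary_value_def
    by (intro Q.borel_measurable_nn_integral) (simp add: split_def)
qed

lemma measurable_elementary_integral:
  assumes "elementary_process M F 0 b N p e"
  shows "elementary_integral W N p e \<in> borel_measurable M"
proof -
  have "e i \<in> borel_measurable M" "0 \<le> p i" "0 \<le> p (Suc i)" if "i < N" for i
    using assms elementary_process_nonneg[OF assms, of i] elementary_process_nonneg[OF assms, of "Suc i"] that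
    by (auto simp: elementary_process_def intro: measurable_filtration[of _ "p i"])
  then show ?thesis
    unfolding elementary_integral_def by (intro borel_measurable_sum borel_measurable_scaleR borel_measurable_indicator) auto
qed

text \<open>The Ito isometry as an upper bound, for integrals with different end times. Replacing
  each \<open>X l\<close> by an elementary integral, applying the isometry and returning to
  \<open>\<sigma>\<close> costs two factors \<open>1 + \<epsilon>\<close> and errors that vanish as
  \<open>j\<close> grows; afterwards \<open>\<epsilon>\<close> tends to 0.\<close>

lemma ito_integral_combination_bound:
  fixes \<sigma> :: "real \<Rightarrow> 'b::euclidean_space" and c :: "'i \<Rightarrow> real"
  assumes L: "finite L"
    and ito: "\<And>l. l \<in> L \<Longrightarrow> has_ito_integral M F W (\<lambda>s \<omega>. \<sigma> s) 0 (t l) (X l)"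
  shows "(\<integral>\<^sup>+\<omega>. ennreal ((norm (\<Sum>l\<in>L. c l *\<^sub>R X l \<omega>))\<^sup>2) \<partial>M) \<le>
    (\<integral>\<^sup>+s. ennreal ((norm (\<Sum>l\<in>L. c l *\<^sub>R (indicator {0..t l} s *\<^sub>R \<sigma> s)))\<^sup>2) \<partial>lebesgue)"
    (is "?Z \<le> ?R")
proof -
  \<comment> \<open>The approximating data \<open>N\<close>, \<open>p\<close>, \<open>e\<close> are
    packed into one nested pair \<open>z\<close>, so that a single choice selects them for all
    \<open>l\<close>.\<close>
  let ?A = "\<lambda>l z. \<forall>j. elementary_process M F 0 (t l) (fst z j) (fst (snd z) j) (snd (snd z) j)"
  let ?D = "\<lambda>l z j. \<integral>\<^sup>+\<omega>. (\<integral>\<^sup>+s. ennreal ((norm (\<sigma> s -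
    elementary_value (fst z j) (fst (snd z) j) (snd (snd z) j) s \<omega>))\<^sup>2) \<partial>lebesgue_on {0..t l}) \<partial>M"
  let ?E = "\<lambda>l z j. \<integral>\<^sup>+\<omega>. ennreal ((norm (X l \<omega> -
    elementary_integral W (fst z j) (fst (snd z) j) (snd (snd z) j) \<omega>))\<^sup>2) \<partial>M"
  have "\<forall>l\<in>L. \<exists>z. ?A l z \<and> ?D l z \<longlonglongrightarrow> 0 \<and> ?E l z \<longlonglongrightarrow> 0"
    using ito unfolding has_ito_integral_def split_paired_Ex fst_conv snd_conv by simp
  then obtain z where z: "\<forall>l\<in>L. ?A l (z l) \<and> ?D l (z l) \<longlonglongrightarrow> 0 \<and> ?E l (z l) \<longlonglongrightarrow> 0"
    using bchoice[of L "\<lambda>l z. ?A l z \<and> ?D l z \<longlonglongrightarrow> 0 \<and> ?E l z \<longlonglongrightarrow> 0"] by blast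
  define N where "N l = fst (z l)" for l
  define p where "p l = fst (snd (z l))" for l
  define e where "e l = snd (snd (z l))" for l
  define D where "D l j = (\<integral>\<^sup>+\<omega>. (\<integral>\<^sup>+s. ennreal ((norm (\<sigma> s - elementary_value (N l j) (p l j) (e l j) s \<omega>))\<^sup>2)
                \<partial>lebesgue_on {0..t l}) \<partial>M)" for l j
  define E where "E l j = (\<integral>\<^sup>+\<omega>. ennreal ((norm (X l \<omega> - elementary_integral W (N l j) (p l j) (e l j) \<omega>))\<^sup>2) \<partial>M)" for l j
  have el: "elementary_process M F 0 (t l) (N l j) (p l j) (e l j)"
    and D0: "D l \<longlonglongrightarrow> 0" and E0: "E l \<longlonglongrightarrow> 0" if "l \<in> L" for l j
    using z that unfolding D_def E_def N_def p_def e_def by auto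
  \<comment> \<open>The definition gives measurability on the product space; a section at some
    sample point recovers it for \<open>\<sigma>\<close>.\<close>
  have \<sigma>m: "\<sigma> \<in> borel_measurable (lebesgue_on {0..t l})" if l: "l \<in> L" for l
  proof -
    obtain \<omega> where "\<omega> \<in> space M"
      using not_empty by blast
    moreover have "case_prod (\<lambda>s \<omega>. \<sigma> s) \<in> borel_measurable (lebesgue_on {0..t l} \<Otimes>\<^sub>M M)"
      using ito[OF l] by (simp add: has_ito_integral_def)
    ultimately show ?thesis
      using measurable_Pair1[of "case_prod (\<lambda>s \<omega>. \<sigma> s)" "lebesgue_on {0..t l}" M borel \<omega>] by simp
  qed
  have Xm: "X l \<in> borel_measurable M" if "l \<in> L" for l
    using ito[OF that] by (simp add: has_ito_integral_def)
  have \<sigma>0m: "(\<lambda>s. indicator {0..t l} s *\<^sub>R \<sigma> s) \<in> borel_measurable lebesgue" if "l \<in> L" for l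
    using \<sigma>m[OF that] by (subst (asm) borel_measurable_restrict_space_iff) auto
  have bound: "?Z \<le> ennreal (1 + \<epsilon>) * (ennreal (1 + \<epsilon>) * ?R)" if \<epsilon>: "0 < \<epsilon>" for \<epsilon> :: real
  proof -
    let ?d = "\<lambda>l. ennreal ((1 + 1 / \<epsilon>) * card L * (c l)\<^sup>2)"
    have "?Z \<le> ennreal (1 + \<epsilon>) * (ennreal (1 + \<epsilon>) * ?R + (\<Sum>l\<in>L. ?d l * D l j)) + (\<Sum>l\<in>L. ?d l * E l j)" for j
    proof -
      let ?EI = "\<lambda>l. elementary_integral W (N l j) (p l j) (e l j)"
      let ?EV = "\<lambda>l. elementary_value (N l j) (p l j) (e l j)"
      have EVm: "(\<lambda>s. ?EV l s \<omega>) \<in> borel_measurable lebesgue" for l \<omega>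
        unfolding elementary_value_def by (intro borel_measurable_sum borel_measurable_scaleR borel_measurable_indicator) auto
      \<comment> \<open>First replacement: each \<open>X l\<close> is an elementary integral plus an
        error that is small in mean square.\<close>
      have "?Z = (\<integral>\<^sup>+\<omega>. ennreal ((norm ((\<Sum>l\<in>L. c l *\<^sub>R ?EI l \<omega>) +
          (\<Sum>l\<in>L. c l *\<^sub>R (X l \<omega> - ?EI l \<omega>))))\<^sup>2) \<partial>M)"
        by (simp add: sum.distrib[symmetric] scaleR_add_right[symmetric])
      also have "\<dots> \<le> ennreal (1 + \<epsilon>) * (\<integral>\<^sup>+\<omega>. ennreal ((norm (\<Sum>l\<in>L. c l *\<^sub>R ?EI l \<omega>))\<^sup>2) \<partial>M) +
          (\<Sum>l\<in>L. ?d l * E l j)"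
        unfolding E_def
        by (intro nn_integral_square_perturbation \<epsilon> borel_measurable_sum borel_measurable_scaleR
            borel_measurable_diff Xm measurable_elementary_integral[OF el]) auto
      also have "(\<integral>\<^sup>+\<omega>. ennreal ((norm (\<Sum>l\<in>L. c l *\<^sub>R ?EI l \<omega>))\<^sup>2) \<partial>M) =
          (\<integral>\<^sup>+\<omega>. (\<integral>\<^sup>+s. ennreal ((norm (\<Sum>l\<in>L. c l *\<^sub>R ?EV l s \<omega>))\<^sup>2) \<partial>lebesgue) \<partial>M)"
        unfolding nn_integral_completion by (rule elementary_combination_isometry[OF L el])
      also have "\<dots> \<le> (\<integral>\<^sup>+\<omega>. (ennreal (1 + \<epsilon>) * ?R + (\<Sum>l\<in>L. ?d l *
          (\<integral>\<^sup>+s. ennreal ((norm (\<sigma> s - ?EV l s \<omega>))\<^sup>2) \<partial>lebesgue_on {0..t l}))) \<partial>M)"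
      proof (rule nn_integral_mono)
        fix \<omega>
        \<comment> \<open>Second replacement, for fixed \<open>\<omega>\<close>: each elementary
          value is \<open>\<sigma>\<close>, cut off to \<open>{0..t l}\<close>, plus an
          error.\<close>
        have "(\<integral>\<^sup>+s. ennreal ((norm (\<Sum>l\<in>L. c l *\<^sub>R ?EV l s \<omega>))\<^sup>2) \<partial>lebesgue) =
          (\<integral>\<^sup>+s. ennreal ((norm ((\<Sum>l\<in>L. c l *\<^sub>R (indicator {0..t l} s *\<^sub>R \<sigma> s)) +
            (\<Sum>l\<in>L. c l *\<^sub>R (?EV l s \<omega> - indicator {0..t l} s *\<^sub>R \<sigma> s))))\<^sup>2) \<partial>lebesgue)"
          by (simp add: sum.distrib[symmetric] scaleR_diff_right)
        also have "\<dots> \<le> ennreal (1 + \<epsilon>) * ?R +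
          (\<Sum>l\<in>L. ?d l * (\<integral>\<^sup>+s. ennreal ((norm (?EV l s \<omega> - indicator {0..t l} s *\<^sub>R \<sigma> s))\<^sup>2) \<partial>lebesgue))"
          by (intro nn_integral_square_perturbation \<epsilon> borel_measurable_sum borel_measurable_scaleR
            borel_measurable_diff \<sigma>0m EVm) (auto intro: \<sigma>0m)
        also have "(\<Sum>l\<in>L. ?d l * (\<integral>\<^sup>+s. ennreal ((norm (?EV l s \<omega> - indicator {0..t l} s *\<^sub>R \<sigma> s))\<^sup>2) \<partial>lebesgue)) =
          (\<Sum>l\<in>L. ?d l * (\<integral>\<^sup>+s. ennreal ((norm (\<sigma> s - ?EV l s \<omega>))\<^sup>2) \<partial>lebesgue_on {0..t l}))"
        proof (intro sum.cong refl arg_cong2[where f="(*)"])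
          fix l assume l: "l \<in> L"
          have "(\<integral>\<^sup>+s. ennreal ((norm (\<sigma> s - ?EV l s \<omega>))\<^sup>2) \<partial>lebesgue_on {0..t l}) =
            (\<integral>\<^sup>+s. ennreal ((norm (\<sigma> s - ?EV l s \<omega>))\<^sup>2) * indicator {0..t l} s \<partial>lebesgue)"
            by (intro nn_integral_restrict_space) simp
          \<comment> \<open>Outside \<open>{0..t l}\<close> the elementary value and the cut-off
            \<open>\<sigma>\<close> both vanish.\<close>
          also have "\<dots> = (\<integral>\<^sup>+s. ennreal ((norm (?EV l s \<omega> - indicator {0..t l} s *\<^sub>R \<sigma> s))\<^sup>2) \<partial>lebesgue)"
            using elementary_value_outside[OF el[OF l]]
            by (intro nn_integral_cong) (auto simp: indicator_def norm_minus_commute)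
          finally show "(\<integral>\<^sup>+s. ennreal ((norm (?EV l s \<omega> - indicator {0..t l} s *\<^sub>R \<sigma> s))\<^sup>2) \<partial>lebesgue) =
            (\<integral>\<^sup>+s. ennreal ((norm (\<sigma> s - ?EV l s \<omega>))\<^sup>2) \<partial>lebesgue_on {0..t l})" by simp
        qed
        finally show "(\<integral>\<^sup>+s. ennreal ((norm (\<Sum>l\<in>L. c l *\<^sub>R ?EV l s \<omega>))\<^sup>2) \<partial>lebesgue) \<le>
          ennreal (1 + \<epsilon>) * ?R + (\<Sum>l\<in>L. ?d l *
          (\<integral>\<^sup>+s. ennreal ((norm (\<sigma> s - ?EV l s \<omega>))\<^sup>2) \<partial>lebesgue_on {0..t l}))" .
      qed
      \<comment> \<open>\<open>?R\<close> does not depend on \<open>\<omega>\<close>, and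
        \<open>M\<close> has total mass 1.\<close>
      also have "\<dots> = ennreal (1 + \<epsilon>) * ?R + (\<Sum>l\<in>L. ?d l * D l j)"
      proof -
        note m = measurable_elementary_value[OF el \<sigma>m]
        show ?thesis
          unfolding D_def using m
          by (subst nn_integral_add; (subst nn_integral_sum)?)
            (auto simp: nn_integral_cmult emeasure_space_1)
      qed
      finally show ?thesis
        by (simp add: add_mono mult_left_mono)
    qed
    moreover have "(\<lambda>j. ennreal (1 + \<epsilon>) * (ennreal (1 + \<epsilon>) * ?R + (\<Sum>l\<in>L. ?d l * D l j)) + (\<Sum>l\<in>L. ?d l * E l j))
      \<longlonglongrightarrow> ennreal (1 + \<epsilon>) * (ennreal (1 + \<epsilon>) * ?R + (\<Sum>l\<in>L. ?d l * 0)) + (\<Sum>l\<in>L. ?d l * 0)"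
      using D0 E0
      by (intro tendsto_add tendsto_const tendsto_sum ennreal_tendsto_cmult) auto
    ultimately show ?thesis
      by (intro LIMSEQ_le_const) auto
  qed
  show ?thesis
  \<comment> \<open>The claim is trivial for infinite \<open>?R\<close>; otherwise
    \<open>\<epsilon>\<close> runs through \<open>1 / (n + 1)\<close>.\<close>
  proof (cases "?R = \<infinity>")
    case False
    have "(\<lambda>n. 1 + inverse (real (Suc n))) \<longlonglongrightarrow> 1 + 0"
      by (intro tendsto_add tendsto_const LIMSEQ_inverse_real_of_nat)
    then have *: "(\<lambda>n. ennreal (1 + inverse (real (Suc n)))) \<longlonglongrightarrow> 1"
      using tendsto_ennrealI by fastforce
    have "(\<lambda>n. ennreal (1 + inverse (real (Suc n))) * (ennreal (1 + inverse (real (Suc n))) * ?R)) \<longlonglongrightarrow> 1 * (1 * ?R)"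
      using False by (intro tendsto_mult_ennreal * tendsto_const) auto
    moreover have "?Z \<le> ennreal (1 + inverse (real (Suc n))) * (ennreal (1 + inverse (real (Suc n))) * ?R)" for n
      by (rule bound) simp
    ultimately show ?thesis
      by (intro LIMSEQ_le_const) auto
  qed simp
qed

end

section \<open>Gronwall's inequality and injectivity of the fundamental matrix\<close>

text \<open>The integral of \<open>u\<close>, multiplied by \<open>exp (- L * r)\<close>, is
  nonincreasing and starts at 0. So the integral is at most 0, and with it \<open>u\<close>.\<close>

lemma gronwall_zero:
  fixes u :: "real \<Rightarrow> real"
  assumes cont: "continuous_on {a..b} u" and nonneg: "\<And>r. r \<in> {a..b} \<Longrightarrow> 0 \<le> u r" and "0 \<le> L"
    and le: "\<And>r. r \<in> {a..b} \<Longrightarrow> u r \<le> L * integral {a..r} u" and r: "r \<in> {a..b}"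
  shows "u r = 0"
proof -
  let ?v = "\<lambda>r. integral {a..r} u"
  let ?g = "\<lambda>r. exp (- L * r) * ?v r"
  have vc: "continuous_on {a..b} ?v"
    by (intro indefinite_integral_continuous_1 integrable_continuous_real cont)
  have "?g r \<le> ?g a"
  proof (rule DERIV_nonpos_imp_decreasing_open[where f="?g"])
    show "a \<le> r" using r by simp
    show "continuous_on {a..r} ?g"
      using r by (intro continuous_intros continuous_on_subset[OF vc]) auto
    fix x assume x: "a < x" "x < r"
    have "(?v has_real_derivative u x) (at x within {a..b})"
      using x r by (intro integral_has_real_derivative cont) auto
    then have d: "(?v has_real_derivative u x) (at x)"
      using x r by (simp add: at_within_Icc_at)
    have "(?g has_real_derivative exp (- L * x) * (u x - L * ?v x)) (at x)"
      by (rule derivative_eq_intros d refl)+ (simp add: algebra_simps)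
    moreover have "exp (- L * x) * (u x - L * ?v x) \<le> 0"
      using le[of x] x r by (intro mult_nonneg_nonpos) auto
    ultimately show "\<exists>y. (?g has_real_derivative y) (at x) \<and> y \<le> 0"
      by blast
  qed
  then have "?v r \<le> 0"
    by (simp add: mult_le_0_iff)
  then have "L * ?v r \<le> 0"
    using assms(3) by (rule mult_nonneg_nonpos[rotated])
  with le[OF r] nonneg[OF r] show ?thesis by linarith
qed

text \<open>The essential supremum is below infinity, so \<open>real_of_ereal\<close> does not fall
  back to the value 0 that it has there.\<close>

lemma Linfty_on_AE_le:
  assumes "Linfty_on D f"
  shows "AE t in lebesgue_on D. norm (f t) \<le> Linfty_norm D f"
proof -
  let ?S = "esssup (lebesgue_on D) (\<lambda>t. ereal (norm (f t)))"
  have "AE t in lebesgue_on D. ereal (norm (f t)) \<le> ?S"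
    by (rule esssup_AE)
  moreover have "?S \<noteq> \<infinity>"
    using assms by (simp add: Linfty_on_def)
  ultimately show ?thesis
    unfolding Linfty_norm_def by (cases ?S) auto
qed

text \<open>Source of joint continuity and of a constant \<open>K\<close> with
  \<open>norm (P ** Q) \<le> norm P * norm Q * K\<close>; the norm of the matrix type is the
  Euclidean norm of the entries.\<close>

lemma bounded_bilinear_matrix_matrix_mult:
  "bounded_bilinear (\<lambda>(P::real^'m^'n) (Q::real^'k^'m). P ** Q)"
  unfolding bilinear_conv_bounded_bilinear[symmetric] bilinear_def
  by (auto intro!: linearI simp: matrix_matrix_mult_def vec_eq_iff sum_distrib_left algebra_simps sum.distrib)

lemma bounded_bilinear_matrix_vector_mult:
  "bounded_bilinear (\<lambda>(P::real^'m^'n) x. P *v x)"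
  unfolding bilinear_conv_bounded_bilinear[symmetric] bilinear_def
  by (auto intro!: linearI simp: matrix_vector_mult_def vec_eq_iff sum_distrib_left algebra_simps sum.distrib)

text \<open>\<open>A\<close> is bounded almost everywhere and \<open>Phi\<close> is continuous on a
  compact interval, so the product is essentially bounded on a set of finite measure.\<close>

lemma fundamental_matrix_integrable:
  fixes A :: "real \<Rightarrow> real^'n^'n"
  assumes Phi: "fundamental_matrix a b A Phi" and A: "Linfty_on {a..b} A" and s: "s \<in> {a..b}"
  shows "integrable (lebesgue_on {a..b}) (\<lambda>r. A r ** Phi r s)"
proof -
  interpret bb: bounded_bilinear "\<lambda>(P::real^'n^'n) (Q::real^'n^'n). P ** Q"
    by (rule bounded_bilinear_matrix_matrix_mult)
  interpret finite_measure "lebesgue_on {a..b}"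
    by (intro finite_measure_lebesgue_on) simp
  have cont: "continuous_on {a..b} (\<lambda>r. Phi r s)"
    using Phi s by (simp add: fundamental_matrix_def)
  have Pm: "(\<lambda>r. Phi r s) \<in> borel_measurable (lebesgue_on {a..b})"
    using cont by (intro continuous_imp_measurable_on_sets_lebesgue) auto
  have Am: "A \<in> borel_measurable (lebesgue_on {a..b})"
    using A by (simp add: Linfty_on_def)
  obtain C where "\<forall>x\<in>(\<lambda>r. Phi r s) ` {a..b}. norm x \<le> C"
    using compact_imp_bounded[OF compact_continuous_image[OF cont compact_Icc]] unfolding bounded_iff by blast
  then have C: "\<And>r. r \<in> {a..b} \<Longrightarrow> norm (Phi r s) \<le> C" by blast
  obtain K where K: "0 < K" "\<And>(P::real^'n^'n) (Q::real^'n^'n). norm (P ** Q) \<le> norm P * norm Q * K"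
    using bb.pos_bounded by blast
  show ?thesis
  proof (rule integrable_const_bound)
    have "continuous_on UNIV (\<lambda>x :: (real^'n^'n) \<times> (real^'n^'n). fst x ** snd x)"
      by (intro bb.continuous_on continuous_intros)
    then show "(\<lambda>r. A r ** Phi r s) \<in> borel_measurable (lebesgue_on {a..b})"
      by (rule borel_measurable_continuous_Pair[OF Am Pm])
    have "AE r in lebesgue_on {a..b}. r \<in> space (lebesgue_on {a..b})"
      by (rule AE_space)
    with Linfty_on_AE_le[OF A]
    show "AE r in lebesgue_on {a..b}. norm (A r ** Phi r s) \<le> Linfty_norm {a..b} A * C * K"
    proof eventually_elim
      case (elim r)
      then have "norm (A r) * norm (Phi r s) * K \<le> Linfty_norm {a..b} A * C * K"
        using C[of r] K(1) by (intro mult_right_mono mult_mono order_trans[OF norm_ge_zero elim(1)]) auto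
      then show ?case using K(2)[of "A r" "Phi r s"] by linarith
    qed
  qed
qed

text \<open>The oriented integral from \<open>s\<close> down to \<open>r\<close> carries the minus
  sign. It is rewritten as a Henstock-Kurzweil integral, the form in which Gronwall's inequality is
  stated.\<close>

lemma fundamental_matrix_backward_eq:
  fixes A :: "real \<Rightarrow> real^'n^'n"
  assumes Phi: "fundamental_matrix a b A Phi" and A: "Linfty_on {a..b} A"
    and rs: "a \<le> r" "r \<le> s" "s \<le> b"
  shows "Phi r s = mat 1 - integral {r..s} (\<lambda>q. A q ** Phi q s)"
proof (cases "r = s")
  case True
  then show ?thesis
    using Phi rs by (simp add: fundamental_matrix_def interval_lebesgue_integral_def set_lebesgue_integral_def)
next
  case False
  let ?f = "\<lambda>q. A q ** Phi q s"
  have "integrable (lebesgue_on {a..b}) ?f"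
    using fundamental_matrix_integrable[OF Phi A] rs by simp
  then have "set_integrable lebesgue {a..b} ?f"
    unfolding set_integrable_def by (subst (asm) integrable_restrict_space) auto
  then have i: "set_integrable lebesgue {r<..<s} ?f"
    using rs by (elim set_integrable_subset) auto
  have "Phi r s = mat 1 + (LINT q=ereal s..ereal r|lebesgue. ?f q)"
    using Phi rs by (simp add: fundamental_matrix_def)
  also have "(LINT q=ereal s..ereal r|lebesgue. ?f q) = - (LINT q:{r<..<s}|lebesgue. ?f q)"
    using False rs by (simp add: interval_lebesgue_integral_def)
  also have "(LINT q:{r<..<s}|lebesgue. ?f q) = integral {r..s} ?f"
    using set_lebesgue_integral_eq_integral(2)[OF i] integral_open_interval_real[of r s ?f] by simp
  finally show ?thesis by simp
qed

text \<open>The equation of the solution is based at \<open>s\<close>, where its value is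
  \<open>x\<close>. Since the solution vanishes at \<open>t\<close>, the equation can be rebased at
  \<open>t\<close> without an initial term, and Gronwall applies on \<open>{t..s}\<close>.\<close>

lemma fundamental_matrix_inj:
  fixes A :: "real \<Rightarrow> real^'n^'n"
  assumes Phi: "fundamental_matrix a b A Phi" and A: "Linfty_on {a..b} A"
    and ts: "a \<le> t" "t \<le> s" "s \<le> b" and zero: "Phi t s *v x = 0"
  shows "x = 0"
proof -
  interpret bv: bounded_bilinear "\<lambda>(P::real^'n^'n) x. P *v x"
    by (rule bounded_bilinear_matrix_vector_mult)
  obtain K where K: "0 < K" "\<And>(P::real^'n^'n) x. norm (P *v x) \<le> norm P * norm x * K"
    using bv.pos_bounded by blast
  \<comment> \<open>\<open>max 0\<close> makes the constant nonnegative without an argument about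
    the essential supremum.\<close>
  define C where "C = max 0 (Linfty_norm {a..b} A) * K"
  have C0: "0 \<le> C" using K(1) by (simp add: C_def)
  define y where "y r = Phi r s *v x" for r
  have "continuous_on {a..b} y"
    unfolding y_def using Phi ts
    by (intro bv.continuous_on continuous_on_const) (simp add: fundamental_matrix_def)
  then have ycont: "continuous_on {t..s} y"
    using ts by (elim continuous_on_subset) auto
  let ?f = "\<lambda>q. A q ** Phi q s" and ?g = "\<lambda>q. A q *v y q"
  have "integrable (lebesgue_on {a..b}) ?f"
    using fundamental_matrix_integrable[OF Phi A] ts by simp
  then have "?f integrable_on {a..b}"
    by (intro integrable_on_lebesgue_on) auto
  then have fi: "?f integrable_on {r..r'}" if "a \<le> r" "r' \<le> b" for r r'
    using that by (elim integrable_subinterval_real) auto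
  have fx: "(\<lambda>q. ?f q *v x) = ?g"
    by (simp add: y_def matrix_vector_mul_assoc fun_eq_iff)
  have gi: "?g integrable_on {r..r'}" if "a \<le> r" "r' \<le> b" for r r'
    using integrable_linear[OF fi[OF that] bv.bounded_linear_left[of x]] fx by (simp add: comp_def)
  have y_eq: "y r = x - integral {r..s} ?g" if "t \<le> r" "r \<le> s" for r
  proof -
    have "y r = x - integral {r..s} ?f *v x"
      unfolding y_def using that ts
      by (subst fundamental_matrix_backward_eq[OF Phi A])
        (auto simp: matrix_vector_mult_diff_rdistrib)
    also have "integral {r..s} ?f *v x = integral {r..s} ?g"
      using integral_linear[OF fi bv.bounded_linear_left[of x], of r s] that ts fx
      by (simp add: comp_def)
    finally show ?thesis .
  qed
  \<comment> \<open>At \<open>r = t\<close> the equation reads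
    \<open>x = integral {t..s} ?g\<close>, because \<open>y t = 0\<close>; this value is substituted
    for \<open>x\<close>.\<close>
  have y_eq': "y r = integral {t..r} ?g" if "t \<le> r" "r \<le> s" for r
  proof -
    have "x = integral {t..s} ?g"
      using y_eq[of t] ts zero by (simp add: y_def)
    also have "\<dots> = integral {t..r} ?g + integral {r..s} ?g"
      using that ts gi[of t s] by (intro Henstock_Kurzweil_Integration.integral_combine[symmetric]) auto
    finally show ?thesis
      using y_eq[OF that] by (simp only: add_diff_cancel_right')
  qed
  have "AE q in lebesgue. q \<in> {a..b} \<longrightarrow> norm (A q) \<le> Linfty_norm {a..b} A"
    using Linfty_on_AE_le[OF A] by (subst (asm) AE_restrict_space_iff) simp_all
  then obtain Z where Zn: "Z \<in> null_sets lebesgue"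
    and Z': "{q \<in> space lebesgue. \<not> (q \<in> {a..b} \<longrightarrow> norm (A q) \<le> Linfty_norm {a..b} A)} \<subseteq> Z"
    unfolding eventually_ae_filter by blast
  have Z: "negligible Z" "\<And>q. q \<in> {a..b} - Z \<Longrightarrow> norm (A q) \<le> Linfty_norm {a..b} A"
    using Zn Z' by (auto simp: negligible_iff_null_sets)
  have bound: "norm (y r) \<le> C * integral {t..r} (\<lambda>q. norm (y q))" if r: "r \<in> {t..s}" for r
  proof -
    \<comment> \<open>Setting the integrand to 0 on the null set \<open>Z\<close> makes the bound
      valid at every point, as the norm estimate for integrals requires.\<close>
    let ?g' = "\<lambda>q. if q \<in> Z then 0 else ?g q"
    have "integral {t..r} ?g = integral {t..r} ?g'"
      by (rule integral_spike[OF Z(1)]) auto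
    moreover have "?g' integrable_on {t..r}"
      by (rule integrable_spike[OF gi[of t r] Z(1)]) (use r ts in auto)
    moreover have ci: "(\<lambda>q. C * norm (y q)) integrable_on {t..r}"
      using r by (intro integrable_continuous_real continuous_intros continuous_on_subset[OF ycont]) auto
    moreover have "norm (?g' q) \<le> C * norm (y q)" if "q \<in> {t..r}" for q
    proof (cases "q \<in> Z")
      case False
      with that r ts have "norm (A q) \<le> max 0 (Linfty_norm {a..b} A)"
        using Z(2)[of q] by (simp add: le_max_iff_disj)
      then have "norm (A q) * norm (y q) * K \<le> max 0 (Linfty_norm {a..b} A) * norm (y q) * K"
        using K(1) by (intro mult_right_mono) auto
      also have "\<dots> = C * norm (y q)"
        by (simp add: C_def)
      finally show ?thesis
        using False K(2)[of "A q" "y q"] by simp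
    qed (use K(1) in \<open>simp add: C_def\<close>)
    ultimately have "norm (integral {t..r} ?g) \<le> integral {t..r} (\<lambda>q. C * norm (y q))"
      using integral_norm_bound_integral[of ?g' "{t..r}" "\<lambda>q. C * norm (y q)"] by simp
    then show ?thesis
      using y_eq'[of r] r by simp
  qed
  have "norm (y s) = 0"
    by (rule gronwall_zero[where u="\<lambda>r. norm (y r)" and a=t and b=s and L=C])
      (use ycont C0 ts bound in \<open>auto intro!: continuous_intros\<close>)
  moreover have "y s = x"
    using y_eq[of s] ts by simp
  ultimately show ?thesis by simp
qed

section \<open>The integrating factor along a single path\<close>

text \<open>With \<open>d = k * (v - u)\<close>, the difference is \<open>exp (k * u)\<close> times
  the sum of two errors. One is \<open>k\<close> times the error of replacing \<open>Y\<close> by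
  \<open>Y v\<close> in the integral, controlled by the oscillation \<open>\<epsilon>\<close>. The
  other is \<open>1 + d - exp d\<close> times \<open>Y v\<close>, quadratic in \<open>d\<close>
  because \<open>d \<le> 1\<close>.\<close>

lemma exponential_sum_step:
  fixes Y :: "real \<Rightarrow> 'b::euclidean_space"
  assumes k: "0 \<le> k" and uv: "u \<le> v" "k * (v - u) \<le> 1" and cont: "continuous_on {u..v} Y"
    and \<epsilon>: "\<And>s. s \<in> {u..v} \<Longrightarrow> norm (Y s - Y v) \<le> \<epsilon>" and C: "norm (Y v) \<le> C"
  shows "norm (exp (k * u) *\<^sub>R (Y v - Y u + k *\<^sub>R integral {u..v} Y) -
      (exp (k * v) *\<^sub>R Y v - exp (k * u) *\<^sub>R Y u)) \<le>
    exp (k * u) * (k * \<epsilon> * (v - u) + (k * (v - u))\<^sup>2 * C)"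
proof -
  let ?d = "k * (v - u)"
  have d0: "0 \<le> ?d" using k uv by simp
  have "integral {u..v} Y - (v - u) *\<^sub>R Y v = integral {u..v} (\<lambda>s. Y s - Y v)"
    using uv cont by (subst Henstock_Kurzweil_Integration.integral_diff) (auto intro: integrable_continuous_real)
  moreover have "norm (integral {u..v} (\<lambda>s. Y s - Y v)) \<le> \<epsilon> * (v - u)"
    using uv \<epsilon> by (intro integral_bound continuous_intros cont) auto
  ultimately have 1: "norm (integral {u..v} Y - (v - u) *\<^sub>R Y v) \<le> \<epsilon> * (v - u)"
    by simp
  have 2: "\<bar>1 + ?d - exp ?d\<bar> \<le> ?d\<^sup>2"
    using exp_bound[OF d0 uv(2)] exp_ge_add_one_self[of ?d] by linarith
  have "exp (k * v) = exp (k * u) * exp ?d"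
    by (simp add: exp_add[symmetric] algebra_simps)
  then have "exp (k * u) *\<^sub>R (Y v - Y u + k *\<^sub>R integral {u..v} Y) -
      (exp (k * v) *\<^sub>R Y v - exp (k * u) *\<^sub>R Y u) =
      exp (k * u) *\<^sub>R (k *\<^sub>R (integral {u..v} Y - (v - u) *\<^sub>R Y v) + (1 + ?d - exp ?d) *\<^sub>R Y v)"
    by (simp add: algebra_simps)
  also have "norm \<dots> \<le> exp (k * u) * (norm (k *\<^sub>R (integral {u..v} Y - (v - u) *\<^sub>R Y v)) +
      norm ((1 + ?d - exp ?d) *\<^sub>R Y v))"
    by (subst norm_scaleR) (auto intro!: mult_left_mono norm_triangle_ineq simp del: norm_scaleR)
  also have "\<dots> \<le> exp (k * u) * (k * \<epsilon> * (v - u) + ?d\<^sup>2 * C)"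
    using mult_left_mono[OF 1 k] mult_mono[OF 2 C] k
    by (intro mult_left_mono add_mono) auto
  finally show ?thesis .
qed

text \<open>The discrete form of \<open>d(exp(k s) Y) = exp(k s) (dY + k Y ds)\<close>.\<close>

lemma exponential_sum_tendsto:
  fixes Y :: "real \<Rightarrow> 'b::euclidean_space" and k t :: real
  assumes k: "0 \<le> k" and t: "0 \<le> t" and cont: "continuous_on {0..t} Y"
    and J: "\<And>r. r \<in> {0..t} \<Longrightarrow> J r = Y r + k *\<^sub>R integral {0..r} Y"
  shows "(\<lambda>n. \<Sum>i<n. exp (k * (t * i / n)) *\<^sub>R (J (t * Suc i / n) - J (t * i / n)))
    \<longlonglongrightarrow> exp (k * t) *\<^sub>R Y t - Y 0"
proof (rule LIMSEQ_I)
  fix e :: real assume e: "0 < e"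
  obtain C where "\<forall>x\<in>Y ` {0..t}. norm x \<le> C"
    using compact_imp_bounded[OF compact_continuous_image[OF cont compact_Icc]] unfolding bounded_iff by blast
  then have C: "\<And>r. r \<in> {0..t} \<Longrightarrow> norm (Y r) \<le> C" by blast
  have C0: "0 \<le> C" using order_trans[OF norm_ge_zero C[of 0]] t by simp
  \<comment> \<open>Keeps the accumulated oscillation error
    \<open>exp (k * t) * (k * \<epsilon> * t)\<close> below \<open>e / 2\<close>; the added 1 keeps
    the denominator positive when \<open>k * t = 0\<close>.\<close>
  define \<epsilon> where "\<epsilon> = e / (2 * exp (k * t) * (k * t + 1))"
  have kt: "0 \<le> k * t" using k t by simp
  have \<epsilon>: "0 < \<epsilon>" using e kt by (simp add: \<epsilon>_def add_nonneg_pos)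
  have small: "exp (k * t) * (k * \<epsilon> * t) < e / 2"
  proof -
    have "x * (k * (e / (2 * x * (k * t + 1))) * t) = e / 2 * (k * t / (k * t + 1))" if "x \<noteq> 0" for x
      using that by simp
    then have "exp (k * t) * (k * \<epsilon> * t) = e / 2 * (k * t / (k * t + 1))"
      by (simp only: \<epsilon>_def exp_not_eq_zero not_False_eq_True)
    also have "\<dots> < e / 2 * 1"
      using e kt by (intro mult_strict_left_mono) (auto simp: divide_less_eq)
    finally show ?thesis by simp
  qed
  obtain \<delta> where \<delta>: "0 < \<delta>" "\<And>x y. x \<in> {0..t} \<Longrightarrow> y \<in> {0..t} \<Longrightarrow> dist y x < \<delta> \<Longrightarrow> dist (Y y) (Y x) < \<epsilon>"
    by (rule uniformly_continuous_onE[OF compact_uniformly_continuous[OF cont compact_Icc] \<epsilon>], rule that)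
  have z: "(\<lambda>n. c / real n) \<longlonglongrightarrow> 0" for c :: real
    by (rule lim_const_over_n)
  \<comment> \<open>The mesh is below the modulus of continuity, \<open>k\<close> times the mesh is
    below 1 as the single step requires, and the quadratic errors, of order \<open>1 / n\<close> in
    total, stay below \<open>e / 2\<close>.\<close>
  have "\<forall>\<^sub>F n in sequentially. t / real n < \<delta> \<and> k * t / real n < 1 \<and>
      exp (k * t) * (k * t)\<^sup>2 * C / real n < e / 2 \<and> 0 < n"
    using e \<delta>(1) by (intro eventually_conj order_tendstoD(2)[OF z] eventually_gt_at_top) auto
  then obtain n0 where n0: "\<And>n. n0 \<le> n \<Longrightarrow> t / real n < \<delta> \<and> k * t / real n < 1 \<and>
      exp (k * t) * (k * t)\<^sup>2 * C / real n < e / 2 \<and> 0 < n"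
    unfolding eventually_sequentially by blast
  have "norm ((\<Sum>i<n. exp (k * (t * i / n)) *\<^sub>R (J (t * Suc i / n) - J (t * i / n))) -
      (exp (k * t) *\<^sub>R Y t - Y 0)) < e" if "n0 \<le> n" for n :: nat
  proof -
    note n = n0[OF that]
    define g where "g i = t * real i / real n" for i :: nat
    have g0: "g 0 = 0" and gn: "g n = t"
      using n by (simp_all add: g_def)
    have gS: "g (Suc i) - g i = t / n" for i
      by (simp add: g_def distrib_left add_divide_distrib)
    have g_in: "g i \<in> {0..t}" if "i \<le> n" for i
      using that n t mult_left_mono[of "real i" "real n" t] by (simp add: g_def divide_le_eq)
    have g_le: "g i \<le> g (Suc i)" for i
      using gS[of i] t by (smt (verit) divide_nonneg_nonneg of_nat_0_le_iff)
    let ?q = "\<lambda>i. exp (k * g i) *\<^sub>R Y (g i)"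
    have step: "norm (exp (k * g i) *\<^sub>R (J (g (Suc i)) - J (g i)) - (?q (Suc i) - ?q i)) \<le>
        exp (k * t) * (k * \<epsilon> * (t / n) + (k * (t / n))\<^sup>2 * C)" if i: "i < n" for i
    proof -
      have sub: "{g i..g (Suc i)} \<subseteq> {0..t}"
        using g_in[of i] g_in[of "Suc i"] i by auto
      have "integral {0..g (Suc i)} Y = integral {0..g i} Y + integral {g i..g (Suc i)} Y"
        using g_in[of i] g_in[of "Suc i"] g_le[of i] i cont
        by (intro Henstock_Kurzweil_Integration.integral_combine[symmetric] integrable_continuous_real)
          (auto elim: continuous_on_subset)
      then have Jd: "J (g (Suc i)) - J (g i) =
          Y (g (Suc i)) - Y (g i) + k *\<^sub>R integral {g i..g (Suc i)} Y"
        using J[OF g_in[of i]] J[OF g_in[of "Suc i"]] i by (simp add: algebra_simps)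
      have "norm (exp (k * g i) *\<^sub>R (J (g (Suc i)) - J (g i)) - (?q (Suc i) - ?q i)) \<le>
          exp (k * g i) * (k * \<epsilon> * (g (Suc i) - g i) + (k * (g (Suc i) - g i))\<^sup>2 * C)"
        unfolding Jd
      proof (rule exponential_sum_step[OF k g_le])
        show "k * (g (Suc i) - g i) \<le> 1" using n unfolding gS times_divide_eq_right by linarith
        show "continuous_on {g i..g (Suc i)} Y" using cont sub by (rule continuous_on_subset)
        show "norm (Y (g (Suc i))) \<le> C" using C g_in[of "Suc i"] i by simp
        fix s assume s: "s \<in> {g i..g (Suc i)}"
        have "dist s (g (Suc i)) < \<delta>"
          using s gS[of i] n by (auto simp: dist_real_def)
        then show "norm (Y s - Y (g (Suc i))) \<le> \<epsilon>"
          using \<delta>(2)[of "g (Suc i)" s] s sub g_in[of "Suc i"] i by (auto simp: dist_norm)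
      qed
      also have "\<dots> \<le> exp (k * t) * (k * \<epsilon> * (t / n) + (k * (t / n))\<^sup>2 * C)"
        unfolding gS using k g_in[of i] i \<epsilon> t C0
        by (intro mult_right_mono) (auto intro!: mult_left_mono add_nonneg_nonneg mult_nonneg_nonneg)
      finally show ?thesis .
    qed
    have "(\<Sum>i<n. exp (k * (t * i / n)) *\<^sub>R (J (t * Suc i / n) - J (t * i / n))) - (exp (k * t) *\<^sub>R Y t - Y 0) =
        (\<Sum>i<n. exp (k * g i) *\<^sub>R (J (g (Suc i)) - J (g i))) - (?q n - ?q 0)"
      unfolding g_def[symmetric] by (simp add: g0 gn)
    \<comment> \<open>Telescoping \<open>?q n - ?q 0\<close> makes the total error the sum of the
      errors of the single steps.\<close>
    also have "\<dots> = (\<Sum>i<n. exp (k * g i) *\<^sub>R (J (g (Suc i)) - J (g i)) - (?q (Suc i) - ?q i))"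
      by (simp only: sum_subtractf sum_lessThan_telescope[of ?q n, symmetric])
    finally have "norm ((\<Sum>i<n. exp (k * (t * i / n)) *\<^sub>R (J (t * Suc i / n) - J (t * i / n))) -
        (exp (k * t) *\<^sub>R Y t - Y 0)) =
        norm (\<Sum>i<n. exp (k * g i) *\<^sub>R (J (g (Suc i)) - J (g i)) - (?q (Suc i) - ?q i))"
      by (rule arg_cong)
    also have "\<dots> \<le> (\<Sum>i<n. exp (k * t) * (k * \<epsilon> * (t / n) + (k * (t / n))\<^sup>2 * C))"
      by (rule order_trans[OF norm_sum sum_mono]) (rule step, simp)
    also have "\<dots> = exp (k * t) * (k * \<epsilon> * t) + exp (k * t) * (k * t)\<^sup>2 * C / n"
    proof -
      have "x * (y * (k * \<epsilon> * (t / x) + (k * (t / x))\<^sup>2 * C)) = y * (k * \<epsilon> * t) + y * (k * t)\<^sup>2 * C / x"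
        if "x \<noteq> 0" for x y :: real
      proof -
        have "x * (y * (k * \<epsilon> * (t / x) + (k * (t / x))\<^sup>2 * C)) =
            y * (k * \<epsilon> * (x * (t / x))) + y * (k * (x * (t / x))) * (k * (t / x)) * C"
          by (simp only: power2_eq_square distrib_left mult_ac)
        also have "x * (t / x) = t" using that by simp
        finally show ?thesis by (simp add: power2_eq_square mult_ac)
      qed
      from this[of "real n" "exp (k * t)"] n show ?thesis
        by (simp only: sum_constant card_lessThan) simp
    qed
    also have "\<dots> < e"
      using small n by linarith
    finally show ?thesis .
  qed
  then show "\<exists>n0. \<forall>n\<ge>n0. norm ((\<Sum>i<n. exp (k * (t * i / n)) *\<^sub>R (J (t * Suc i / n) - J (t * i / n))) -
      (exp (k * t) *\<^sub>R Y t - Y 0)) < e"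
    by blast
qed

section \<open>Right inverse of the delayed input matrix\<close>

text \<open>The witness is \<open>R ** L\<close>, with \<open>R\<close> a right inverse of the
  full-rank matrix \<open>B (t + h)\<close> and \<open>L\<close> the inverse of the injective square
  matrix \<open>Phi t (t + h)\<close>.\<close>

lemma delayed_input_right_inverse:
  fixes A :: "real \<Rightarrow> real^'n^'n" and B :: "real \<Rightarrow> real^'m^'n"
  assumes Phi: "fundamental_matrix a b A Phi" and A: "Linfty_on {a..b} A"
    and t: "a \<le> t" "0 \<le> h" "t + h \<le> b" and rank: "rank (B (t + h)) = CARD('n)"
  shows "\<exists>K :: real^'n^'m. delayed_input Phi B h t ** K = mat 1"
proof -
  let ?P = "Phi t (t + h)" and ?B = "B (t + h)"
  have "\<exists>R. ?B ** R = mat 1"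
    using rank by (simp add: matrix_right_invertible_surjective full_rank_surjective)
  then obtain R where R: "?B ** R = mat 1" ..
  have "\<forall>x. ?P *v x = 0 \<longrightarrow> x = 0"
    using fundamental_matrix_inj[OF Phi A, of t "t + h"] t by auto
  then obtain L where "L ** ?P = mat 1"
    using matrix_left_invertible_ker by blast
  then have L: "?P ** L = mat 1"
    using matrix_left_right_inverse by blast
  have "delayed_input Phi B h t ** (R ** L) = ?P ** (?B ** R) ** L"
    by (simp add: delayed_input_def matrix_mul_assoc)
  then have "delayed_input Phi B h t ** (R ** L) = mat 1"
    by (simp add: R L)
  then show ?thesis ..
qed

section \<open>Second moment of the damped equation\<close>

text \<open>For \<open>s \<ge> 0\<close> the sum is a step function: between \<open>g i\<close>
  (excluded) and \<open>g (Suc i)\<close> (included) it is \<open>exp (k * g i)\<close>, the value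
  at the left end, hence at most \<open>exp (k * s)\<close>. It is the weight of
  \<open>\<sigma>\<close> in the exponential sum of Ito increments.\<close>

lemma exponential_step_bounds:
  fixes g :: "nat \<Rightarrow> real"
  assumes k: "0 \<le> k" and g: "mono g"
  shows "0 \<le> (\<Sum>i<n. exp (k * g i) * (indicator {0..g (Suc i)} s - indicator {0..g i} s))"
    and "(\<Sum>i<n. exp (k * g i) * (indicator {0..g (Suc i)} s - indicator {0..g i} s))
      \<le> exp (k * s) * indicator {0..g n} s"
proof -
  have "0 \<le> (\<Sum>i<n. exp (k * g i) * (indicator {0..g (Suc i)} s - indicator {0..g i} s)) \<and>
      (\<Sum>i<n. exp (k * g i) * (indicator {0..g (Suc i)} s - indicator {0..g i} s))
      \<le> exp (k * s) * indicator {0..g n} s"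
  proof (induction n)
    case (Suc n)
    have le: "g n \<le> g (Suc n)" using g by (auto simp: mono_def)
    show ?case
    proof (cases "s \<in> {0..g (Suc n)} - {0..g n}")
      case True
      then have "exp (k * g n) \<le> exp (k * s)"
        using k by (auto intro: mult_left_mono)
      with Suc True show ?thesis by auto
    next
      case False
      then have "(indicator {0..g (Suc n)} s :: real) = indicator {0..g n} s"
        using le by (auto simp: indicator_def)
      with Suc show ?thesis by simp
    qed
  qed simp
  then show "0 \<le> (\<Sum>i<n. exp (k * g i) * (indicator {0..g (Suc i)} s - indicator {0..g i} s))"
    and "(\<Sum>i<n. exp (k * g i) * (indicator {0..g (Suc i)} s - indicator {0..g i} s))
      \<le> exp (k * s) * indicator {0..g n} s" by auto
qed

lemma nn_integral_exp_Icc: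
  assumes "0 < c" "0 \<le> t" "0 \<le> K"
  shows "(\<integral>\<^sup>+s. ennreal (K * exp (c * s) * indicator {0..t} s) \<partial>lebesgue) = ennreal (K * (exp (c * t) - 1) / c)"
proof -
  have "(\<integral>\<^sup>+s. ennreal (K * exp (c * s) * indicator {0..t} s) \<partial>lborel) =
      (\<integral>\<^sup>+s. ennreal (K * exp (c * s)) * indicator {0..t} s \<partial>lborel)"
    by (intro nn_integral_cong) (auto simp: indicator_def)
  also have "\<dots> = ennreal (K * exp (c * t) / c - K * exp (c * 0) / c)"
  proof (intro nn_integral_has_integral_lebesgue' fundamental_theorem_of_calculus)
    fix s
    show "((\<lambda>s. K * exp (c * s) / c) has_vector_derivative K * exp (c * s)) (at s within {0..t})"
      using assms unfolding has_real_derivative_iff_has_vector_derivative[symmetric]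
      by (auto intro!: derivative_eq_intros)
  qed (use assms in auto)
  also have "K * exp (c * t) / c - K * exp (c * 0) / c = K * (exp (c * t) - 1) / c"
    by (simp add: diff_divide_distrib right_diff_distrib)
  finally show ?thesis by (simp add: nn_integral_completion)
qed

context wiener_space
begin

text \<open>The bound for combinations, with a single index, gives second moment 0, since the
  integrand is supported in one point. This is what yields \<open>Y 0 = 0\<close> almost
  surely.\<close>

lemma ito_integral_trivial_interval:
  fixes \<sigma> :: "real \<Rightarrow> 'b::euclidean_space"
  assumes "has_ito_integral M F W (\<lambda>s \<omega>. \<sigma> s) 0 0 X"
  shows "AE \<omega> in M. X \<omega> = 0"
proof -
  have Xm: "X \<in> borel_measurable M"
    using assms by (simp add: has_ito_integral_def)
  have "AE s in lebesgue. s \<notin> {0::real}"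
    by (intro AE_not_in) (simp add: null_setsI)
  then have "(\<integral>\<^sup>+s. ennreal ((norm (\<Sum>l\<in>{()}. 1 *\<^sub>R (indicator {0..0} s *\<^sub>R \<sigma> s)))\<^sup>2) \<partial>lebesgue) =
      (\<integral>\<^sup>+s. 0 \<partial>(lebesgue :: real measure))"
    by (intro nn_integral_cong_AE) (elim eventually_mono, auto)
  then have "(\<integral>\<^sup>+\<omega>. ennreal ((norm (X \<omega>))\<^sup>2) \<partial>M) = 0"
    using ito_integral_combination_bound[of "{()}" \<sigma> "\<lambda>_. 0" "\<lambda>_. X" "\<lambda>_. 1"] assms by simp
  then show ?thesis
    using Xm by (simp add: nn_integral_0_iff_AE)
qed

text \<open>As a combination of the \<open>I i\<close>, the sum has the integrand
  \<open>?\<phi> s *\<^sub>R \<sigma> s\<close>, whose norm is at most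
  \<open>C * exp (k * s)\<close> for almost every \<open>s\<close> in \<open>{0..g n}\<close>. The
  right-hand side is the integral of the square of that bound.\<close>

lemma exponential_ito_sum_bound:
  fixes \<sigma> :: "real \<Rightarrow> 'b::euclidean_space"
  assumes k: "0 < k" and g: "mono g" "0 \<le> g 0"
    and ito: "\<And>i. i \<le> n \<Longrightarrow> has_ito_integral M F W (\<lambda>s \<omega>. \<sigma> s) 0 (g i) (I i)"
    and C: "AE s in lebesgue. s \<in> {0..g n} \<longrightarrow> norm (\<sigma> s) \<le> C"
  shows "(\<integral>\<^sup>+\<omega>. ennreal ((norm (\<Sum>i<n. exp (k * g i) *\<^sub>R (I (Suc i) \<omega> - I i \<omega>)))\<^sup>2) \<partial>M)
    \<le> ennreal (C\<^sup>2 * (exp (2 * k * g n) - 1) / (2 * k))"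
proof -
  \<comment> \<open>Each increment contributes two terms; the boolean tells the upper end
    (\<open>True\<close>) from the lower end.\<close>
  let ?L = "{..<n} \<times> (UNIV :: bool set)"
  let ?j = "\<lambda>(i, b). if b then Suc i else i"
  let ?c = "\<lambda>(i, b). if b then exp (k * g i) else - exp (k * g i)"
  let ?\<phi> = "\<lambda>s. \<Sum>i<n. exp (k * g i) * (indicator {0..g (Suc i)} s - indicator {0..g i} s)"
  have pair: "(\<Sum>l\<in>?L. f l) = (\<Sum>i<n. f (i, True) + f (i, False))" for f :: "nat \<times> bool \<Rightarrow> 'b"
    by (simp add: sum.cartesian_product' UNIV_bool add.commute)
  have gn: "0 \<le> g n"
    using g by (meson mono_def order_trans zero_le)
  have "(\<integral>\<^sup>+\<omega>. ennreal ((norm (\<Sum>i<n. exp (k * g i) *\<^sub>R (I (Suc i) \<omega> - I i \<omega>)))\<^sup>2) \<partial>M) =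
      (\<integral>\<^sup>+\<omega>. ennreal ((norm (\<Sum>l\<in>?L. ?c l *\<^sub>R I (?j l) \<omega>))\<^sup>2) \<partial>M)"
    unfolding pair by (simp add: scaleR_diff_right)
  also have "\<dots> \<le> (\<integral>\<^sup>+s. ennreal ((norm (\<Sum>l\<in>?L. ?c l *\<^sub>R (indicator {0..g (?j l)} s *\<^sub>R \<sigma> s)))\<^sup>2) \<partial>lebesgue)"
    by (rule ito_integral_combination_bound) (auto intro!: ito)
  also have "\<dots> = (\<integral>\<^sup>+s. ennreal ((norm (?\<phi> s *\<^sub>R \<sigma> s))\<^sup>2) \<partial>lebesgue)"
    unfolding pair by (simp add: scaleR_sum_left right_diff_distrib scaleR_diff_left)
  also have "\<dots> \<le> (\<integral>\<^sup>+s. ennreal (C\<^sup>2 * exp (2 * k * s) * indicator {0..g n} s) \<partial>lebesgue)"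
  proof (rule nn_integral_mono_AE)
    show "AE s in lebesgue. ennreal ((norm (?\<phi> s *\<^sub>R \<sigma> s))\<^sup>2) \<le>
        ennreal (C\<^sup>2 * exp (2 * k * s) * indicator {0..g n} s)"
      using C
    proof eventually_elim
      case (elim s)
      note \<phi> = exponential_step_bounds[OF less_imp_le[OF k] g(1), where s=s and n=n]
      show ?case
      proof (cases "s \<in> {0..g n}")
        case True
        with \<phi> have "\<bar>?\<phi> s\<bar> \<le> exp (k * s)" by simp
        moreover have "norm (\<sigma> s) \<le> C" using elim True by simp
        ultimately have "norm (?\<phi> s *\<^sub>R \<sigma> s) \<le> exp (k * s) * C"
          unfolding norm_scaleR by (intro mult_mono) auto
        then have "(norm (?\<phi> s *\<^sub>R \<sigma> s))\<^sup>2 \<le> (exp (k * s) * C)\<^sup>2"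
          by (intro power_mono) auto
        also have "\<dots> = C\<^sup>2 * exp (2 * k * s)"
          by (simp add: power_mult_distrib exp_double[symmetric] mult_ac)
        finally show ?thesis using True by (intro ennreal_leI) simp
      next
        case False
        \<comment> \<open>Here the upper bound of the step function is 0, like the lower
          one.\<close>
        with \<phi> have "?\<phi> s = 0" by simp
        then show ?thesis by simp
      qed
    qed
  qed
  also have "\<dots> = ennreal (C\<^sup>2 * (exp (2 * k * g n) - 1) / (2 * k))"
    using k gn by (intro nn_integral_exp_Icc) auto
  finally show ?thesis .
qed

lemma damped_solution_second_moment:
  fixes \<sigma> :: "real \<Rightarrow> 'b::euclidean_space"
  assumes k: "0 < k" and sol: "ito_solution M F W \<tau> b \<sigma> 0 Y"
    and b: "\<And>s \<omega>. s \<in> {0..\<tau>} \<Longrightarrow> b s \<omega> = - (k *\<^sub>R Y s \<omega>)"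
    and C: "AE s in lebesgue. s \<in> {0..\<tau>} \<longrightarrow> norm (\<sigma> s) \<le> C" and t: "t \<in> {0..\<tau>}"
  shows "(\<integral>\<^sup>+\<omega>. ennreal ((norm (Y t \<omega>))\<^sup>2) \<partial>M) \<le> ennreal (C\<^sup>2 / (2 * k))"
proof -
  have "\<forall>r\<in>{0..\<tau>}. \<exists>I. has_ito_integral M F W (\<lambda>s \<omega>. \<sigma> s) 0 r I \<and>
        (AE \<omega> in M. Y r \<omega> = 0 + (LINT s|lebesgue_on {0..r}. b s \<omega>) + I \<omega>)"
    using sol by (simp add: ito_solution_def)
  \<comment> \<open>One version of the Ito integral is fixed for every time. These versions carry no
    path regularity, so they are evaluated at countably many grid points only.\<close>
  from bchoice[OF this] obtain I where
    ito: "\<And>r. r \<in> {0..\<tau>} \<Longrightarrow> has_ito_integral M F W (\<lambda>s \<omega>. \<sigma> s) 0 r (I r)"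
    and Y: "\<And>r. r \<in> {0..\<tau>} \<Longrightarrow> AE \<omega> in M. Y r \<omega> = 0 + (LINT s|lebesgue_on {0..r}. b s \<omega>) + I r \<omega>"
    by blast
  have Ym: "Y t \<in> borel_measurable M"
    using sol t measurable_filtration[of "Y t" t] by (auto simp: ito_solution_def)
  have Im: "I r \<in> borel_measurable M" if "r \<in> {0..\<tau>}" for r
    using ito[OF that] by (simp add: has_ito_integral_def)
  \<comment> \<open>For \<open>n = 0\<close> division by zero gives
    \<open>g 0 i = 0\<close>.\<close>
  define g where "g n i = t * real i / real n" for n i :: nat
  have g_in: "g n i \<in> {0..\<tau>}" if "i \<le> n" for n i
  proof -
    have "t * real i \<le> t * real n" using t that by (intro mult_left_mono) auto
    then have "g n i \<le> t" using t by (cases "n = 0") (auto simp: g_def divide_le_eq)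
    with t show ?thesis by (auto simp: g_def)
  qed
  define Z where "Z n \<omega> = (\<Sum>i<n. exp (k * g n i) *\<^sub>R (I (g n (Suc i)) \<omega> - I (g n i) \<omega>))" for n \<omega>
  have Zm: "Z n \<in> borel_measurable M" for n
    unfolding Z_def by (intro borel_measurable_sum borel_measurable_scaleR borel_measurable_diff
        borel_measurable_const Im g_in) auto
  \<comment> \<open>The grid points of all partitions are countably many, so one null set serves
    them all.\<close>
  have "AE \<omega> in M. \<forall>n. \<forall>i. i \<le> n \<longrightarrow>
      Y (g n i) \<omega> = 0 + (LINT s|lebesgue_on {0..g n i}. b s \<omega>) + I (g n i) \<omega>"
    unfolding AE_all_countable using Y g_in by (intro allI) (auto intro: AE_impI)
  moreover have "AE \<omega> in M. I 0 \<omega> = 0"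
    using ito[of 0] t by (intro ito_integral_trivial_interval) auto
  moreover have "AE \<omega> in M. continuous_on {0..\<tau>} (\<lambda>t. Y t \<omega>)"
    using sol by (simp add: ito_solution_def)
  ultimately have lim: "AE \<omega> in M. (\<lambda>n. Z n \<omega>) \<longlonglongrightarrow> exp (k * t) *\<^sub>R Y t \<omega>"
  proof eventually_elim
    case (elim \<omega>)
    \<comment> \<open>\<open>?J\<close> is given by the path of \<open>Y\<close> at all times and
      agrees with \<open>I\<close> at the grid points, so the pathwise limit applies to it.\<close>
    let ?J = "\<lambda>r. Y r \<omega> + k *\<^sub>R integral {0..r} (\<lambda>s. Y s \<omega>)"
    have drift: "(LINT s|lebesgue_on {0..r}. b s \<omega>) = - (k *\<^sub>R integral {0..r} (\<lambda>s. Y s \<omega>))"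
      if r: "r \<in> {0..\<tau>}" for r
    proof -
      have "(LINT s|lebesgue_on {0..r}. b s \<omega>) = (LINT s|lebesgue_on {0..r}. - (k *\<^sub>R Y s \<omega>))"
        using r b by (intro Bochner_Integration.integral_cong) auto
      also have "\<dots> = - (k *\<^sub>R (LINT s|lebesgue_on {0..r}. Y s \<omega>))"
        by simp
      also have "(LINT s|lebesgue_on {0..r}. Y s \<omega>) = integral {0..r} (\<lambda>s. Y s \<omega>)"
      proof (rule lebesgue_integral_eq_integral)
        show "integrable (lebesgue_on {0..r}) (\<lambda>s. Y s \<omega>)"
          using r by (intro continuous_imp_integrable_real continuous_on_subset[OF elim(3)]) auto
      qed simp
      finally show ?thesis .
    qed
    have IJ: "I (g n i) \<omega> = ?J (g n i)" if "i \<le> n" for n i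
      using elim(1)[rule_format, OF that] drift[OF g_in[OF that]] by simp
    \<comment> \<open>Read off at the grid point \<open>g 0 0 = 0\<close>.\<close>
    have "Y 0 \<omega> = 0"
      using elim(1)[rule_format, of 0 0] drift[of 0] t elim(2) by (simp add: g_def)
    moreover have "(\<lambda>n. \<Sum>i<n. exp (k * (t * i / n)) *\<^sub>R (?J (t * Suc i / n) - ?J (t * i / n)))
        \<longlonglongrightarrow> exp (k * t) *\<^sub>R Y t \<omega> - Y 0 \<omega>"
      using k t by (intro exponential_sum_tendsto continuous_on_subset[OF elim(3)]) auto
    moreover have "Z n \<omega> = (\<Sum>i<n. exp (k * (t * i / n)) *\<^sub>R (?J (t * Suc i / n) - ?J (t * i / n)))" for n
      unfolding Z_def g_def[symmetric] by (intro sum.cong refl) (simp add: IJ)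
    ultimately show ?case by simp
  qed
  have Z_bound: "(\<integral>\<^sup>+\<omega>. ennreal ((norm (Z n \<omega>))\<^sup>2) \<partial>M) \<le> ennreal (C\<^sup>2 * (exp (2 * k * t) - 1) / (2 * k))"
    for n
  \<comment> \<open>The last grid point is \<open>t\<close> for positive \<open>n\<close> only;
    \<open>Z 0\<close> is an empty sum.\<close>
  proof (cases "n = 0")
    case True
    then show ?thesis by (simp add: Z_def)
  next
    case False
    then have gn: "g n n = t" by (simp add: g_def)
    show ?thesis
      unfolding Z_def gn[symmetric]
    proof (rule exponential_ito_sum_bound[OF k])
      show "mono (g n)"
        using t by (intro monoI) (simp add: g_def divide_right_mono mult_left_mono)
      show "AE s in lebesgue. s \<in> {0..g n n} \<longrightarrow> norm (\<sigma> s) \<le> C"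
        using C by eventually_elim (use t in \<open>auto simp: gn\<close>)
      show "has_ito_integral M F W (\<lambda>s \<omega>. \<sigma> s) 0 (g n i) (I (g n i))" if "i \<le> n" for i
        using ito g_in that by blast
    qed (simp add: g_def)
  qed
  have "ennreal (exp (2 * k * t)) * (\<integral>\<^sup>+\<omega>. ennreal ((norm (Y t \<omega>))\<^sup>2) \<partial>M) =
      (\<integral>\<^sup>+\<omega>. ennreal (exp (2 * k * t)) * ennreal ((norm (Y t \<omega>))\<^sup>2) \<partial>M)"
    using Ym by (intro nn_integral_cmult[symmetric]) auto
  also have "\<dots> = (\<integral>\<^sup>+\<omega>. liminf (\<lambda>n. ennreal ((norm (Z n \<omega>))\<^sup>2)) \<partial>M)"
  proof (rule nn_integral_cong_AE)
    show "AE \<omega> in M. ennreal (exp (2 * k * t)) * ennreal ((norm (Y t \<omega>))\<^sup>2) =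
        liminf (\<lambda>n. ennreal ((norm (Z n \<omega>))\<^sup>2))"
      using lim
    proof eventually_elim
      case (elim \<omega>)
      have "(\<lambda>n. ennreal ((norm (Z n \<omega>))\<^sup>2)) \<longlonglongrightarrow> ennreal ((norm (exp (k * t) *\<^sub>R Y t \<omega>))\<^sup>2)"
        by (intro tendsto_ennrealI tendsto_power tendsto_norm elim)
      then have "liminf (\<lambda>n. ennreal ((norm (Z n \<omega>))\<^sup>2)) = ennreal ((norm (exp (k * t) *\<^sub>R Y t \<omega>))\<^sup>2)"
        by (intro lim_imp_Liminf) auto
      then show ?case
        by (simp add: power_mult_distrib ennreal_mult[symmetric] exp_double[symmetric] mult_ac)
    qed
  qed
  also have "\<dots> \<le> liminf (\<lambda>n. \<integral>\<^sup>+\<omega>. ennreal ((norm (Z n \<omega>))\<^sup>2) \<partial>M)"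
    using Zm by (intro nn_integral_liminf) auto
  also have "\<dots> \<le> ennreal (C\<^sup>2 * (exp (2 * k * t) - 1) / (2 * k))"
    using Z_bound by (intro Liminf_le always_eventually) auto
  also have "\<dots> \<le> ennreal (exp (2 * k * t)) * ennreal (C\<^sup>2 / (2 * k))"
    unfolding ennreal_mult[symmetric, OF exp_ge_zero]
  proof (subst ennreal_mult[symmetric])
    show "ennreal (C\<^sup>2 * (exp (2 * k * t) - 1) / (2 * k)) \<le> ennreal (exp (2 * k * t) * (C\<^sup>2 / (2 * k)))"
      using k by (intro ennreal_leI) (simp add: field_simps)
  qed (use k in auto)
  \<comment> \<open>Multiplication by the inverse exponential cancels the weight, since the integral
    is not yet known to be finite.\<close>
  finally have "ennreal (exp (- (2 * k * t))) * (ennreal (exp (2 * k * t)) * (\<integral>\<^sup>+\<omega>. ennreal ((norm (Y t \<omega>))\<^sup>2) \<partial>M)) \<le>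
      ennreal (exp (- (2 * k * t))) * (ennreal (exp (2 * k * t)) * ennreal (C\<^sup>2 / (2 * k)))"
    by (rule mult_left_mono) simp
  then show ?thesis
    by (simp add: mult.assoc[symmetric] ennreal_mult[symmetric] exp_add[symmetric])
qed

end

section \<open>The closed loop and the quadratic form\<close>

theorem lemma14:
  fixes A :: "real \<Rightarrow> real^'n^'n"
    and B :: "real \<Rightarrow> real^'m^'n"
    and \<sigma> :: "real \<Rightarrow> real^'n"
    and S :: "real^'n^'n"
    and Phi :: "real \<Rightarrow> real \<Rightarrow> real^'n^'n"
    and T h :: real
    and M :: "'w measure"
    and F :: "real \<Rightarrow> 'w measure"
    and W :: "real \<Rightarrow> 'w \<Rightarrow> real"
  assumes "0 < T" and "0 < h" and "h < T"
    and "filtered_prob_space M F"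
    and "wiener_process M F W"
    and "Linfty_on {0..T + h} A"
    and "Linfty_on {0..T + h} B"
    and "Linfty_on {0..T} \<sigma>"
    and "fundamental_matrix 0 (T + h) A Phi"
    and "\<forall>\<tau>. 0 < \<tau> \<and> \<tau> < T + h \<longrightarrow> invertible (gramian Phi B \<tau> (T + h))"
    and "\<forall>t\<in>{0..T - h}. rank (B (t + h)) = CARD('n)"
    and "transpose S = S"
    and "pos_semidef S"
  shows "(\<forall>t\<in>{0..T - h}. \<exists>Kt :: real^'n^'m. delayed_input Phi B h t ** Kt = mat 1) \<and>
    (\<forall>K :: real \<Rightarrow> real^'n^'m.
       (\<forall>t\<in>{0..T - h}. delayed_input Phi B h t ** K t = mat 1) \<longrightarrow>
       (\<forall>(k::real) Y. 1 \<le> k \<longrightarrow>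
          ito_solution M F W (T - h)
            (\<lambda>t \<omega>. A t *v Y t \<omega> + delayed_input Phi B h t *v feedback_control A K k Y t \<omega>)
            \<sigma> 0 Y \<longrightarrow>
          (\<forall>t\<in>{0..T - h}.
             integrable M (\<lambda>\<omega>. Y t \<omega> \<bullet> (S *v Y t \<omega>)) \<and>
             (\<integral>\<omega>. Y t \<omega> \<bullet> (S *v Y t \<omega>) \<partial>M)
               \<le> onorm ((*v) S) * (Linfty_norm {0..T} \<sigma>)\<^sup>2 / (2 * k))))"
proof (intro conjI ballI allI impI)
  fix t assume "t \<in> {0..T - h}"
  then show "\<exists>Kt :: real^'n^'m. delayed_input Phi B h t ** Kt = mat 1"
    using assms by (intro delayed_input_right_inverse[of 0 "T + h" A Phi t h B]) auto
next
  fix K :: "real \<Rightarrow> real^'n^'m" and k :: real and Y t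
  assume K: "\<forall>t\<in>{0..T - h}. delayed_input Phi B h t ** K t = mat 1" and k: "1 \<le> k"
    and sol: "ito_solution M F W (T - h)
            (\<lambda>t \<omega>. A t *v Y t \<omega> + delayed_input Phi B h t *v feedback_control A K k Y t \<omega>)
            \<sigma> 0 Y"
    and t: "t \<in> {0..T - h}"
  interpret wiener_space M F W
    using assms by unfold_locales
  let ?C = "Linfty_norm {0..T} \<sigma>" and ?S = "onorm ((*v) S)"
  \<comment> \<open>The right inverse cancels the delayed input matrix, so the feedback removes
    \<open>A\<close> and leaves only the damping.\<close>
  have closed_loop: "A s *v Y s \<omega> + delayed_input Phi B h s *v feedback_control A K k Y s \<omega> = - (k *\<^sub>R Y s \<omega>)"
    if "s \<in> {0..T - h}" for s \<omega>
  proof -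
    have "delayed_input Phi B h s *v feedback_control A K k Y s \<omega> =
        - ((delayed_input Phi B h s ** K s) *v ((A s + k *\<^sub>R mat 1) *v Y s \<omega>))"
      by (simp add: feedback_control_def matrix_vector_mul_assoc matrix_mul_assoc vec.neg)
    also have "\<dots> = - (A s *v Y s \<omega> + k *\<^sub>R Y s \<omega>)"
      using K that by (simp add: matrix_vector_mult_add_rdistrib scaleR_matrix_vector_assoc[symmetric])
    finally show ?thesis by simp
  qed
  have "AE s in lebesgue. s \<in> {0..T} \<longrightarrow> norm (\<sigma> s) \<le> ?C"
    using Linfty_on_AE_le[of "{0..T}" \<sigma>] assms(8) by (subst (asm) AE_restrict_space_iff) auto
  then have "AE s in lebesgue. s \<in> {0..T - h} \<longrightarrow> norm (\<sigma> s) \<le> ?C"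
    by eventually_elim (use assms(2) in auto)
  then have moment: "(\<integral>\<^sup>+\<omega>. ennreal ((norm (Y t \<omega>))\<^sup>2) \<partial>M) \<le> ennreal (?C\<^sup>2 / (2 * k))"
    using k by (intro damped_solution_second_moment[OF _ sol closed_loop _ t]) auto
  have Ym [measurable]: "Y t \<in> borel_measurable M"
    using sol t measurable_filtration[of "Y t" t] by (auto simp: ito_solution_def)
  have i: "integrable M (\<lambda>\<omega>. (norm (Y t \<omega>))\<^sup>2)"
    using moment by (intro integrableI_nonneg) (auto intro: le_less_trans)
  have e: "(\<integral>\<omega>. (norm (Y t \<omega>))\<^sup>2 \<partial>M) \<le> ?C\<^sup>2 / (2 * k)"
    using moment k by (subst (asm) nn_integral_eq_integral[OF i]) auto
  have lin: "bounded_linear ((*v) S)"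
    by (rule matrix_vector_mul_bounded_linear)
  \<comment> \<open>The bound on the absolute value gives both integrability and the estimate of the
    expectation.\<close>
  have q: "\<bar>Y t \<omega> \<bullet> (S *v Y t \<omega>)\<bar> \<le> ?S * (norm (Y t \<omega>))\<^sup>2" for \<omega>
  proof -
    have "\<bar>Y t \<omega> \<bullet> (S *v Y t \<omega>)\<bar> \<le> norm (Y t \<omega>) * norm (S *v Y t \<omega>)"
      by (rule Cauchy_Schwarz_ineq2)
    also have "\<dots> \<le> norm (Y t \<omega>) * (?S * norm (Y t \<omega>))"
      by (intro mult_left_mono onorm[OF lin]) simp
    finally show ?thesis by (simp add: power2_eq_square mult_ac)
  qed
  have "continuous_on UNIV ((*v) S)"
    by (intro linear_continuous_on lin)
  then have "(\<lambda>\<omega>. S *v Y t \<omega>) \<in> borel_measurable M"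
    using borel_measurable_continuous_onI Ym measurable_compose by blast
  then have qm: "(\<lambda>\<omega>. Y t \<omega> \<bullet> (S *v Y t \<omega>)) \<in> borel_measurable M"
    by (intro borel_measurable_inner Ym)
  \<comment> \<open>The Bochner integral of a non-integrable function is 0, so the bound on the
    expectation has its meaning only together with integrability.\<close>
  show int: "integrable M (\<lambda>\<omega>. Y t \<omega> \<bullet> (S *v Y t \<omega>))"
    using q onorm_pos_le[OF lin]
    by (intro Bochner_Integration.integrable_bound[OF integrable_mult_right[OF i, of ?S] qm])
      (auto intro!: AE_I2)
  have "(\<integral>\<omega>. Y t \<omega> \<bullet> (S *v Y t \<omega>) \<partial>M) \<le> (\<integral>\<omega>. ?S * (norm (Y t \<omega>))\<^sup>2 \<partial>M)"
    using q by (intro integral_mono int integrable_mult_right i) (auto intro: order_trans[OF abs_ge_self])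
  also have "\<dots> \<le> ?S * (?C\<^sup>2 / (2 * k))"
    using mult_left_mono[OF e onorm_pos_le[OF lin]] by simp
  finally show "(\<integral>\<omega>. Y t \<omega> \<bullet> (S *v Y t \<omega>) \<partial>M) \<le> ?S * ?C\<^sup>2 / (2 * k)"
    by simp
qed

end
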